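(* Let $1/2<p<1$ and $\beta=\frac{p}{2p-1}$. In the infinite-colour urn process with parameter $p$, let $N_n$ be the total number of balls in the urn at time $n$ and let $M_n$ be the number of balls of the leading colour at time $n$, i.e. the maximum over all colours of the number of balls of that colour at time $n$. Then there is a random variable $\mu>0$ such that $$\lim_{n\to\infty}\frac{M_n}{\mu N_n^{1/\beta}}=1\quad\text{almost surely.}$$
   Context: Infinite-colour urn process with parameter $p$: at time $0$ the urn contains a single ball of some colour. At each time step $n\ge 1$, a ball is chosen uniformly at random from the urn, independently of the past given the current content. With probability $p$ the ball is returned to the urn along with another ball of the same colour; with probability $1-p$ the ball is recoloured with a brand new colour (one that has never appeared before) and returned to the urn. A colour whose last ball is recoloured never appears again. *)

theory Defs
  imports "HOL-Probability.Probability"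
begin

text \<open>
  Colours are named by natural numbers in order of first appearance. A state \<open>(k, u)\<close> consists of the
  number \<open>k\<close> of colours that have appeared so far, which are \<open>0, \<dots>, k - 1\<close> (some may have
  died out), and the multiset \<open>u\<close> of the colours of the balls in the urn. Hence \<open>k\<close> is always a colour
  that has never appeared before, and keeping \<open>k\<close> in the state rules out the return of extinct colours.
\<close>

type_synonym urn_state = "nat \<times> nat multiset"

text \<open>
  Drawing from \<open>pmf_of_multiset u\<close> chooses a ball uniformly and returns its colour, i.e. colour \<open>c\<close> has
  probability \<open>count u c / size u\<close>.
\<close>

definition urn_step :: "real \<Rightarrow> urn_state \<Rightarrow> urn_state pmf" where
  "urn_step p s =
     (let (k, u) = s in
      bind_pmf (pmf_of_multiset u) (\<lambda>c.
      bind_pmf (bernoulli_pmf p) (\<lambda>copy.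
      return_pmf
        (if copy then (k, add_mset c u)
         else (Suc k, add_mset k (u - {#c#}))))))"

text \<open>
  The process lives on an arbitrary probability space. Assumption \<open>transition\<close> is the Markov
  property with kernel \<^const>\<open>urn_step\<close>, written without division by possibly null events.
\<close>

locale infinite_colour_urn = prob_space M
  for M :: "'a measure" +
  fixes p :: real
    and X :: "nat \<Rightarrow> 'a \<Rightarrow> urn_state"
  assumes p_range: "0 \<le> p" "p \<le> 1"
    and random_state: "\<And>n. X n \<in> measurable M (count_space UNIV)"
    and initial: "AE \<omega> in M. X 0 \<omega> = (1, {#0#})"
    and transition: "\<And>n (s :: nat \<Rightarrow> urn_state).
      prob {\<omega> \<in> space M. \<forall>i\<le>Suc n. X i \<omega> = s i} =
      prob {\<omega> \<in> space M. \<forall>i\<le>n. X i \<omega> = s i} * pmf (urn_step p (s n)) (s (Suc n))"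

definition num_balls :: "urn_state \<Rightarrow> nat" where
  "num_balls s = size (snd s)"

definition leading_count :: "urn_state \<Rightarrow> nat" where
  "leading_count s = (MAX c. count (snd s) c)"

text \<open>The maximum over all (infinitely many) colours is over a finite set of values.\<close>

lemma finite_range_count: "finite (range (count (u :: 'c multiset)))"
proof (rule finite_subset)
  show "range (count u) \<subseteq> insert 0 (count u ` set_mset u)"
    by (auto simp: not_in_iff)
qed simp

end

theory Submission
  imports Defs "HOL-Real_Asymp.Real_Asymp"
begin

text \<open>
  Everything is read off the rising moments \<open>S\<^sub>k = (\<Sum>c. x\<^sub>c (x\<^sub>c + 1) \<cdots> (x\<^sub>c + k - 1))\<close> of the colour
  counts \<open>x\<^sub>c\<close>. With \<open>N\<close> balls in the urn, \<open>V\<^sub>k = w\<^sub>k(N) S\<^sub>k\<close> is a submartingale for a deterministic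
  weight \<open>w\<^sub>k(N)\<close> of order \<open>N powr (- k / \<beta>)\<close>; no law of large numbers for \<open>N\<close> is needed. If \<open>k > \<beta>\<close>,
  the square of \<open>V\<^sub>k\<close> is comparable, uniformly in the state, to a supermartingale. Hence \<open>V\<^sub>k\<close> converges
  almost surely, and a conditional second moment argument shows that from every state the limit is
  positive with probability bounded below, so it is positive almost surely. Thus
  \<open>S\<^sub>k / N powr (k / \<beta>)\<close> has a positive limit for every large \<open>k\<close>. The leading count is the limit of
  the \<open>k\<close>-norms of the counts as \<open>k \<rightarrow> \<infinity>\<close>, and interpolating between these norms transfers the
  convergence to \<open>M / N powr (1 / \<beta>)\<close>.
\<close>

section \<open>The urn as a Markov chain\<close>

text \<open>Rising factorials are used because copying a ball acts on them diagonally: x ->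
  \<open>pochhammer x j\<close> is an eigenfunction of x (f (x + 1) - f x), and x (f (x - 1) - f x)
  brings in only the order j - 1. In mean, a step thus acts on the moment of order k through factors
  depending on N alone, which the weight cancels. What remains is positive: the moment of order k -
  1 over N, and k! for a newborn colour. These two terms are the obstacle to a supermartingale
  bound. The lower moments are absorbed by a combination whose coefficients grow geometrically
  towards low orders. The newborn colours cost a multiple of the weight at each step, and N keeps a
  given value for 1/p steps on average, so the total cost is finite exactly when N powr (- k /
  \<beta>) is summable, that is k > \<beta>; in the code this is \<open>p < real k * drift\<close>.
  Conditioning is always expressed by nonnegative test functions of the past, and positivity of the
  limit is extracted from its Laplace transform.\<close>

lemma countable_multiset: "countable (UNIV :: 'c::countable multiset set)"
proof -
  have "UNIV = range (mset :: 'c list \<Rightarrow> _)"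
    using ex_mset by (metis UNIV_eq_I rangeI)
  then show ?thesis
    by (metis countable_image countableI_type)
qed

lemma countable_urn_state_lists: "countable (UNIV :: urn_state list set)"
proof -
  have "countable (UNIV \<times> UNIV :: urn_state set)"
    by (intro countable_SIGMA countableI_type countable_multiset)
  then show ?thesis
    using countable_lists[of "UNIV :: urn_state set"] by simp
qed

definition admissible :: "urn_state \<Rightarrow> bool" where
  "admissible s \<longleftrightarrow> snd s \<noteq> {#} \<and> set_mset (snd s) \<subseteq> {..<fst s}"

definition step_exp :: "real \<Rightarrow> (urn_state \<Rightarrow> real) \<Rightarrow> urn_state \<Rightarrow> real" where
  "step_exp p \<phi> s = measure_pmf.expectation (urn_step p s) \<phi>"

lemma set_pmf_urn_step:
  assumes "admissible s" "t \<in> set_pmf (urn_step p s)"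
  obtains c where "c \<in># snd s" "t = (fst s, add_mset c (snd s))"
  | c where "c \<in># snd s" "t = (Suc (fst s), add_mset (fst s) (snd s - {#c#}))"
  using assms by (auto simp: urn_step_def admissible_def split: prod.splits if_splits)

lemma finite_set_pmf_urn_step:
  assumes "admissible s"
  shows "finite (set_pmf (urn_step p s))"
proof (rule finite_subset)
  show "set_pmf (urn_step p s) \<subseteq> (\<lambda>c. (fst s, add_mset c (snd s))) ` set_mset (snd s)
    \<union> (\<lambda>c. (Suc (fst s), add_mset (fst s) (snd s - {#c#}))) ` set_mset (snd s)"
    using assms by (auto elim!: set_pmf_urn_step)
qed simp

lemma admissible_urn_step:
  assumes "admissible s" "t \<in> set_pmf (urn_step p s)"
  shows "admissible t"
  by (rule set_pmf_urn_step[OF assms]) (use assms(1) in \<open>auto simp: admissible_def dest!: in_diffD\<close>)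

lemma step_exp_eq:
  assumes "admissible s" "0 \<le> p" "p \<le> 1"
  shows "step_exp p \<phi> s = (\<Sum>c<fst s. real (count (snd s) c) / real (size (snd s)) *
     (p * \<phi> (fst s, add_mset c (snd s)) + (1 - p) * \<phi> (Suc (fst s), add_mset (fst s) (snd s - {#c#}))))"
proof -
  obtain k u where s: "s = (k, u)" by (cases s)
  have u: "u \<noteq> {#}" "set_mset u \<subseteq> {..<k}" using assms by (auto simp: admissible_def s)
  have fin: "finite (set_pmf (bernoulli_pmf p \<bind> (\<lambda>copy. return_pmf
        (if copy then (k, add_mset c u) else (Suc k, add_mset k (u - {#c#}))))))" for c
    by simp
  show ?thesis
    unfolding step_exp_def urn_step_def s
    apply simp
    apply (subst pmf_expectation_bind[where A = "{..<k}"])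
    subgoal by simp
    subgoal using fin by simp
    subgoal using u by simp
    apply (rule sum.cong)
     apply simp
    apply (subst pmf_expectation_bind[where A = UNIV])
    using assms u by (auto simp: UNIV_bool field_simps)
qed

section \<open>The law of a finite path\<close>

primrec path_pmf :: "real \<Rightarrow> nat \<Rightarrow> urn_state list pmf" where
  "path_pmf p 0 = return_pmf [(1, {#0#})]"
| "path_pmf p (Suc n) =
     bind_pmf (path_pmf p n) (\<lambda>l. map_pmf (\<lambda>t. l @ [t]) (urn_step p (last l)))"

lemma set_pmf_path_pmf:
  "l \<in> set_pmf (path_pmf p n) \<Longrightarrow> length l = Suc n \<and> (\<forall>s\<in>set l. admissible s)"
proof (induction n arbitrary: l)
  case 0
  then show ?case by (simp add: admissible_def)
next
  case (Suc n)
  then obtain l' t where l: "l' \<in> set_pmf (path_pmf p n)" "t \<in> set_pmf (urn_step p (last l'))"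
    "l = l' @ [t]" by auto
  with Suc.IH[OF l(1)] have "admissible (last l')" by (metis last_in_set length_0_conv nat.distinct(1))
  with admissible_urn_step[OF this l(2)] Suc.IH[OF l(1)] l(3) show ?case by auto
qed

lemma admissible_last_path:
  "l \<in> set_pmf (path_pmf p n) \<Longrightarrow> l \<noteq> [] \<and> admissible (last l)"
  using set_pmf_path_pmf[of l p n] by (metis last_in_set length_0_conv nat.distinct(1))

lemma finite_path_pmf: "finite (set_pmf (path_pmf p n))"
  by (induction n) (auto simp: admissible_last_path finite_set_pmf_urn_step)

lemma pmf_path_pmf_snoc:
  "pmf (path_pmf p (Suc n)) (l @ [t]) = pmf (path_pmf p n) l * pmf (urn_step p (last l)) t"
proof -
  have inj: "inj (\<lambda>t. l @ [t])" for l :: "urn_state list" by (auto simp: inj_on_def)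
  have "pmf (path_pmf p (Suc n)) (l @ [t]) =
    measure_pmf.expectation (path_pmf p n) (\<lambda>l'. pmf (map_pmf (\<lambda>t. l' @ [t]) (urn_step p (last l'))) (l @ [t]))"
    by (simp add: pmf_bind)
  also have "(\<lambda>l'. pmf (map_pmf (\<lambda>t. l' @ [t]) (urn_step p (last l'))) (l @ [t])) =
      (\<lambda>l'. indicator {l} l' * pmf (urn_step p (last l)) t)"
  proof
    fix l' show "pmf (map_pmf (\<lambda>t. l' @ [t]) (urn_step p (last l'))) (l @ [t]) =
      indicator {l} l' * pmf (urn_step p (last l)) t"
      using pmf_map_inj'[OF inj[of l], of "urn_step p (last l)" t]
      by (cases "l' = l") (auto simp: pmf_eq_0_set_pmf)
  qed
  also have "measure_pmf.expectation (path_pmf p n) \<dots> = pmf (path_pmf p n) l * pmf (urn_step p (last l)) t"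
    by (simp add: pmf.rep_eq)
  finally show ?thesis .
qed

context infinite_colour_urn
begin

definition path :: "nat \<Rightarrow> 'a \<Rightarrow> urn_state list" where
  "path n \<omega> = map (\<lambda>i. X i \<omega>) [0..<Suc n]"

lemma path_Suc: "path (Suc n) \<omega> = path n \<omega> @ [X (Suc n) \<omega>]"
  by (simp add: path_def)

lemma last_path: "last (path n \<omega>) = X n \<omega>"
  by (simp add: path_def)

lemma path_eq_iff:
  "length l = Suc n \<Longrightarrow> path n \<omega> = l \<longleftrightarrow> (\<forall>i\<le>n. X i \<omega> = l ! i)"
  unfolding path_def list_eq_iff_nth_eq
  by (simp add: less_Suc_eq_le del: upt_Suc)

lemma length_path: "length (path n \<omega>) = Suc n"
  by (simp add: path_def)

lemma path_event_sets: "{\<omega> \<in> space M. path n \<omega> = l} \<in> sets M"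
proof (cases "length l = Suc n")
  case True
  have "X i -` {l ! i} \<inter> space M \<in> sets M" for i
    by (rule measurable_sets[OF random_state]) simp
  then have "(\<Inter>i\<in>{..n}. X i -` {l ! i} \<inter> space M) \<in> sets M"
    by (intro sets.finite_INT) simp_all
  also have "(\<Inter>i\<in>{..n}. X i -` {l ! i} \<inter> space M) = {\<omega> \<in> space M. path n \<omega> = l}"
    unfolding path_eq_iff[OF True] by blast
  finally show ?thesis .
next
  case False
  then have "{\<omega> \<in> space M. path n \<omega> = l} = {}" using length_path by blast
  then show ?thesis by (metis sets.empty_sets)
qed

lemma path_measurable [measurable]: "path n \<in> measurable M (count_space UNIV)"
proof (subst measurable_count_space_eq_countable)
  show "countable (UNIV :: urn_state list set)" by (rule countable_urn_state_lists)
  have "path n -` {l} \<inter> space M = {\<omega> \<in> space M. path n \<omega> = l}" for l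
    by auto
  then show "path n \<in> space M \<rightarrow> UNIV \<and> (\<forall>a\<in>UNIV. path n -` {a} \<inter> space M \<in> sets M)"
    using path_event_sets[of n] by simp
qed

lemma prob_path: "prob {\<omega> \<in> space M. path n \<omega> = l} = pmf (path_pmf p n) l"
proof (induction n arbitrary: l)
  case 0
  show ?case
  proof (cases "l = [(1, {#0#})]")
    case True
    have "prob {\<omega> \<in> space M. path 0 \<omega> = l} = 1"
      using initial path_event_sets[of 0 l]
      by (subst prob_Collect_eq_1) (simp_all add: True path_def)
    then show ?thesis using True by simp
  next
    case False
    have "prob {\<omega> \<in> space M. path 0 \<omega> = l} = 0"
      using initial path_event_sets[of 0 l] False
      by (subst prob_Collect_eq_0) (auto simp: path_def)
    then show ?thesis using False by (simp add: pmf_return)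
  qed
next
  case (Suc n)
  show ?case
  proof (cases "length l = Suc (Suc n)")
    case True
    then obtain l' t where l: "l = l' @ [t]" "length l' = Suc n"
      by (metis length_Suc_conv_rev)
    then have last: "last l' = l ! n"
      by (metis diff_Suc_1 last_conv_nth length_0_conv lessI nat.distinct(1) nth_append)
    have nth: "l ! i = l' ! i" if "i \<le> n" for i using l that by (simp add: nth_append)
    have "prob {\<omega> \<in> space M. path (Suc n) \<omega> = l} = prob {\<omega> \<in> space M. \<forall>i\<le>Suc n. X i \<omega> = l ! i}"
      using True by (simp add: path_eq_iff)
    also have "\<dots> = prob {\<omega> \<in> space M. \<forall>i\<le>n. X i \<omega> = l ! i} * pmf (urn_step p (l ! n)) (l ! Suc n)"
      by (rule transition)
    also have "{\<omega> \<in> space M. \<forall>i\<le>n. X i \<omega> = l ! i} = {\<omega> \<in> space M. path n \<omega> = l'}"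
      using nth l by (simp add: path_eq_iff)
    also have "prob \<dots> * pmf (urn_step p (l ! n)) (l ! Suc n) =
        pmf (path_pmf p n) l' * pmf (urn_step p (last l')) t"
      using Suc.IH last l by (simp add: nth_append)
    finally show ?thesis using l pmf_path_pmf_snoc by simp
  next
    case False
    then have "path (Suc n) \<omega> \<noteq> l" for \<omega> using length_path by metis
    moreover have "l \<notin> set_pmf (path_pmf p (Suc n))"
      using set_pmf_path_pmf[of l p "Suc n"] False by blast
    ultimately show ?thesis by (simp add: pmf_eq_0_set_pmf del: path_pmf.simps)
  qed
qed

text \<open>The path law on the right has finite support, so expectations of functions of the path
  are finite sums and integrability never restricts the function.\<close>

lemma distr_path: "distr M (count_space UNIV) (path n) = measure_pmf (path_pmf p n)"
proof (rule measure_eqI_countable[of _ UNIV])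
  fix l :: "urn_state list"
  have "emeasure (distr M (count_space UNIV) (path n)) {l} = emeasure M (path n -` {l} \<inter> space M)"
    by (simp add: emeasure_distr)
  also have "path n -` {l} \<inter> space M = {\<omega> \<in> space M. path n \<omega> = l}" by auto
  also have "emeasure M \<dots> = ennreal (pmf (path_pmf p n) l)"
    by (simp add: emeasure_eq_measure prob_path)
  finally show "emeasure (distr M (count_space UNIV) (path n)) {l} = emeasure (measure_pmf (path_pmf p n)) {l}"
    by (simp add: emeasure_pmf_single)
qed (auto simp: countable_urn_state_lists)

lemma AE_path: "AE \<omega> in M. path n \<omega> \<in> set_pmf (path_pmf p n)"
proof -
  have "AE l in distr M (count_space UNIV) (path n). l \<in> set_pmf (path_pmf p n)"
    unfolding distr_path by (simp add: AE_measure_pmf)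
  then show ?thesis by (subst (asm) AE_distr_iff) auto
qed

lemma AE_admissible: "AE \<omega> in M. \<forall>n. admissible (X n \<omega>)"
proof (subst AE_all_countable, intro allI)
  fix n show "AE \<omega> in M. admissible (X n \<omega>)"
    using AE_path[of n] by eventually_elim (use admissible_last_path last_path in metis)
qed

lemma integrable_path: "integrable M (\<lambda>\<omega>. h (path n \<omega>) :: real)"
  using integrable_measure_pmf_finite[OF finite_path_pmf[of p n], of h]
  unfolding distr_path[symmetric] by (subst (asm) integrable_distr_eq) auto

lemma expectation_path:
  "expectation (\<lambda>\<omega>. h (path n \<omega>) :: real) = measure_pmf.expectation (path_pmf p n) h"
  unfolding distr_path[symmetric] by (subst integral_distr) auto

text \<open>
  Measurability with respect to \<open>X 0, \<dots>, X n\<close>: the path up to time \<open>n\<close> has finitely many values, so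
  factoring through it is the only condition.
\<close>

definition adapted :: "nat \<Rightarrow> ('a \<Rightarrow> real) \<Rightarrow> bool" where
  "adapted n H \<longleftrightarrow> (\<forall>\<omega> \<omega>'. (\<forall>i\<le>n. X i \<omega> = X i \<omega>') \<longrightarrow> H \<omega> = H \<omega>')"

lemma adapted_path:
  assumes "adapted n H"
  obtains h where "H = (\<lambda>\<omega>. h (path n \<omega>))"
proof -
  have "X i \<omega> = X i \<omega>'" if "path n \<omega> = path n \<omega>'" "i \<le> n" for \<omega> \<omega>' i
    using arg_cong[OF that(1), of "\<lambda>l. l ! i"] that(2) by (simp add: path_def del: upt_Suc)
  then have "H \<omega> = H \<omega>'" if "path n \<omega> = path n \<omega>'" for \<omega> \<omega>'
    using assms that unfolding adapted_def by blast
  then have "\<exists>h. H = h \<circ> path n"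
    by (subst function_factors_left[symmetric]) blast
  then show ?thesis using that by (auto simp: o_def)
qed

lemma adapted_integrable: "adapted n H \<Longrightarrow> integrable M H"
  by (erule adapted_path) (simp add: integrable_path)

lemma adapted_state: "i \<le> n \<Longrightarrow> adapted n (\<lambda>\<omega>. \<phi> (X i \<omega>))"
  by (auto simp: adapted_def)

lemma adapted_mono: "adapted n H \<Longrightarrow> n \<le> m \<Longrightarrow> adapted m H"
  by (auto simp: adapted_def)

lemma adapted_comp2: "adapted n G \<Longrightarrow> adapted n H \<Longrightarrow> adapted n (\<lambda>\<omega>. f (G \<omega>) (H \<omega>))"
  unfolding adapted_def by (intro allI impI arg_cong2[where f = f]) blast+

lemmas adapted_mult = adapted_comp2[where f = "(*)"]

lemma adapted_const: "adapted n (\<lambda>\<omega>. c)"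
  by (simp add: adapted_def)

text \<open>This is the Markov property in tested form: \<open>H\<close> stands for the past, so the
  later martingale arguments multiply by a nonnegative adapted function instead of taking
  conditional expectations.\<close>

lemma expectation_step:
  assumes "adapted n H"
  shows "expectation (\<lambda>\<omega>. H \<omega> * \<phi> (X (Suc n) \<omega>)) = expectation (\<lambda>\<omega>. H \<omega> * step_exp p \<phi> (X n \<omega>))"
proof -
  obtain h where H: "H = (\<lambda>\<omega>. h (path n \<omega>))" using adapted_path[OF assms] .
  have "expectation (\<lambda>\<omega>. H \<omega> * \<phi> (X (Suc n) \<omega>)) =
      expectation (\<lambda>\<omega>. (\<lambda>l. h (butlast l) * \<phi> (last l)) (path (Suc n) \<omega>))"
    by (simp add: H path_Suc)
  also have "\<dots> = measure_pmf.expectation (path_pmf p (Suc n)) (\<lambda>l. h (butlast l) * \<phi> (last l))"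
    by (rule expectation_path)
  also have "\<dots> = (\<Sum>l\<in>set_pmf (path_pmf p n). pmf (path_pmf p n) l * (h l * step_exp p \<phi> (last l)))"
    unfolding path_pmf.simps
    by (subst pmf_expectation_bind[where A = "set_pmf (path_pmf p n)"])
      (auto simp: finite_path_pmf admissible_last_path finite_set_pmf_urn_step step_exp_def)
  also have "\<dots> = measure_pmf.expectation (path_pmf p n) (\<lambda>l. h l * step_exp p \<phi> (last l))"
    by (subst integral_measure_pmf[OF finite_path_pmf]) auto
  also have "\<dots> = expectation (\<lambda>\<omega>. (\<lambda>l. h l * step_exp p \<phi> (last l)) (path n \<omega>))"
    by (rule expectation_path[symmetric])
  finally show ?thesis by (simp add: H last_path)
qed

lemma submartingale_step:
  assumes "adapted n H" "\<And>\<omega>. 0 \<le> H \<omega>" "\<And>s. admissible s \<Longrightarrow> \<phi> s \<le> step_exp p \<phi> s"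
  shows "expectation (\<lambda>\<omega>. H \<omega> * \<phi> (X n \<omega>)) \<le> expectation (\<lambda>\<omega>. H \<omega> * \<phi> (X (Suc n) \<omega>))"
  unfolding expectation_step[OF assms(1)]
proof (rule integral_mono_AE)
  show "integrable M (\<lambda>\<omega>. H \<omega> * \<phi> (X n \<omega>))" "integrable M (\<lambda>\<omega>. H \<omega> * step_exp p \<phi> (X n \<omega>))"
    by (intro adapted_integrable[of n] adapted_mult assms adapted_state order_refl)+
  show "AE \<omega> in M. H \<omega> * \<phi> (X n \<omega>) \<le> H \<omega> * step_exp p \<phi> (X n \<omega>)"
    using AE_admissible by eventually_elim (simp add: assms mult_left_mono)
qed

lemma submartingale_mono:
  assumes "adapted n H" "\<And>\<omega>. 0 \<le> H \<omega>" "\<And>s. admissible s \<Longrightarrow> \<phi> s \<le> step_exp p \<phi> s" "n \<le> m"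
  shows "expectation (\<lambda>\<omega>. H \<omega> * \<phi> (X n \<omega>)) \<le> expectation (\<lambda>\<omega>. H \<omega> * \<phi> (X m \<omega>))"
  using assms(4)
proof (induction m rule: dec_induct)
  case (step m)
  then show ?case
    using submartingale_step[OF adapted_mono[OF assms(1)] assms(2,3), of m] by linarith
qed simp

lemma step_exp_uminus: "step_exp p (\<lambda>s. - \<phi> s) s = - step_exp p \<phi> s"
  by (simp add: step_exp_def)

lemma supermartingale_mono:
  assumes "adapted n H" "\<And>\<omega>. 0 \<le> H \<omega>" "\<And>s. admissible s \<Longrightarrow> step_exp p \<phi> s \<le> \<phi> s" "n \<le> m"
  shows "expectation (\<lambda>\<omega>. H \<omega> * \<phi> (X m \<omega>)) \<le> expectation (\<lambda>\<omega>. H \<omega> * \<phi> (X n \<omega>))"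
  using submartingale_mono[OF assms(1,2), of "\<lambda>s. - \<phi> s" m] assms(3,4)
  by (simp add: step_exp_uminus)

end

section \<open>One-step expectations of additive functionals\<close>

text \<open>The index set contains all colours ever seen, extinct ones with count 0. A dying colour
  therefore stays in the sum as \<open>f 0\<close>, and only a birth changes the index set.\<close>

definition colour_sum :: "(nat \<Rightarrow> real) \<Rightarrow> urn_state \<Rightarrow> real" where
  "colour_sum f s = (\<Sum>c<fst s. f (count (snd s) c))"

lemma colour_sum_copy:
  assumes "c < fst s"
  shows "colour_sum f (fst s, add_mset c (snd s)) =
    colour_sum f s + (f (Suc (count (snd s) c)) - f (count (snd s) c))"
proof -
  have "colour_sum f (fst s, add_mset c (snd s)) =
      f (Suc (count (snd s) c)) + (\<Sum>d\<in>{..<fst s} - {c}. f (count (snd s) d))"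
    using assms by (simp add: colour_sum_def sum.remove[of "{..<fst s}" c])
  then show ?thesis using assms by (simp add: colour_sum_def sum.remove[of "{..<fst s}" c])
qed

lemma colour_sum_recolour:
  assumes "c < fst s" "admissible s"
  shows "colour_sum f (Suc (fst s), add_mset (fst s) (snd s - {#c#})) =
    colour_sum f s + (f (count (snd s) c - 1) - f (count (snd s) c)) + f 1"
proof -
  have "count (snd s) (fst s) = 0"
    using assms(2) by (auto simp: admissible_def count_eq_zero_iff)
  then have "colour_sum f (Suc (fst s), add_mset (fst s) (snd s - {#c#})) =
      f 1 + (\<Sum>d<fst s. f (count (snd s - {#c#}) d))"
    using assms(1) by (simp add: colour_sum_def)
  also have "(\<Sum>d<fst s. f (count (snd s - {#c#}) d)) =
      f (count (snd s) c - 1) + (\<Sum>d\<in>{..<fst s} - {c}. f (count (snd s) d))"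
    using assms(1) by (simp add: sum.remove[of "{..<fst s}" c])
  finally show ?thesis using assms by (simp add: colour_sum_def sum.remove[of "{..<fst s}" c])
qed

lemma colour_sum_mono:
  "(\<And>x. f x \<le> g x) \<Longrightarrow> colour_sum f s \<le> colour_sum g s"
  by (simp add: colour_sum_def sum_mono)

lemma colour_sum_nonneg: "(\<And>x. 0 \<le> f x) \<Longrightarrow> 0 \<le> colour_sum f s"
  by (simp add: colour_sum_def sum_nonneg)

lemma colour_sum_cmult: "colour_sum (\<lambda>x. a * f x) s = a * colour_sum f s"
  by (simp add: colour_sum_def sum_distrib_left)

lemma num_balls_eq_colour_sum:
  assumes "admissible s"
  shows "real (num_balls s) = colour_sum real s"
proof -
  have "num_balls s = (\<Sum>c<fst s. count (snd s) c)"
    unfolding num_balls_def size_multiset_overloaded_eq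
    using assms by (intro sum.mono_neutral_left) (auto simp: admissible_def count_eq_zero_iff)
  then show ?thesis by (simp add: colour_sum_def)
qed

lemma num_balls_pos: "admissible s \<Longrightarrow> 0 < num_balls s"
  by (auto simp: admissible_def num_balls_def nonempty_has_size[symmetric])

text \<open>The premise is restricted to colours still in the urn: an extinct colour is drawn with
  probability 0, and for it the formula \<open>num_balls_recolour\<close> would fail.\<close>

lemma step_exp_eq':
  assumes "admissible s" "0 \<le> p" "p \<le> 1"
    and "\<And>c. c < fst s \<Longrightarrow> c \<in># snd s \<Longrightarrow>
       p * \<phi> (fst s, add_mset c (snd s)) + (1 - p) * \<phi> (Suc (fst s), add_mset (fst s) (snd s - {#c#}))
       = \<psi> (count (snd s) c)"
  shows "step_exp p \<phi> s = colour_sum (\<lambda>x. real x * \<psi> x) s / real (num_balls s)"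
  unfolding step_exp_eq[OF assms(1-3)] colour_sum_def sum_divide_distrib num_balls_def
proof (rule sum.cong)
  fix c assume "c \<in> {..<fst s}"
  then show "real (count (snd s) c) / real (size (snd s)) *
         (p * \<phi> (fst s, add_mset c (snd s)) +
          (1 - p) * \<phi> (Suc (fst s), add_mset (fst s) (snd s - {#c#}))) =
         real (count (snd s) c) * \<psi> (count (snd s) c) / real (size (snd s))"
    using assms(4)[of c] by (cases "c \<in># snd s") (auto simp: not_in_iff)
qed simp

lemma num_balls_copy: "num_balls (fst s, add_mset c (snd s)) = Suc (num_balls s)"
  by (simp add: num_balls_def)

lemma num_balls_recolour:
  "c \<in># snd s \<Longrightarrow> num_balls (Suc (fst s), add_mset (fst s) (snd s - {#c#})) = num_balls s"
  by (simp add: num_balls_def size_Suc_Diff1)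

lemma step_exp_num_balls:
  assumes "admissible s" "0 \<le> p" "p \<le> 1"
  shows "step_exp p (\<lambda>s. w (num_balls s)) s =
    p * w (Suc (num_balls s)) + (1 - p) * w (num_balls s)"
  using num_balls_pos[OF assms(1)] num_balls_eq_colour_sum[OF assms(1)]
  by (subst step_exp_eq'[OF assms, where \<psi> = "\<lambda>x. p * w (Suc (num_balls s)) + (1 - p) * w (num_balls s)"])
    (auto simp: num_balls_copy num_balls_recolour mult.commute[of "real _"] colour_sum_cmult)

lemma step_exp_colour_sum:
  assumes "admissible s" "0 \<le> p" "p \<le> 1"
  defines "N \<equiv> num_balls s"
  shows "step_exp p (\<lambda>s. w (num_balls s) * colour_sum f s) s =
    p * w (Suc N) * (colour_sum f s + colour_sum (\<lambda>x. real x * (f (Suc x) - f x)) s / N) +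
    (1 - p) * w N * (colour_sum f s + f 1 + colour_sum (\<lambda>x. real x * (f (x - 1) - f x)) s / N)"
proof -
  let ?F = "colour_sum f s"
  have "step_exp p (\<lambda>s. w (num_balls s) * colour_sum f s) s =
    colour_sum (\<lambda>x. real x * (p * (w (Suc N) * (?F + (f (Suc x) - f x))) +
      (1 - p) * (w N * (?F + (f (x - 1) - f x) + f 1)))) s / real N"
    unfolding N_def using assms(1-3)
    by (intro step_exp_eq')
      (simp_all add: num_balls_copy num_balls_recolour colour_sum_copy colour_sum_recolour)
  also have "colour_sum (\<lambda>x. real x * (p * (w (Suc N) * (?F + (f (Suc x) - f x))) +
      (1 - p) * (w N * (?F + (f (x - 1) - f x) + f 1)))) s =
     (p * w (Suc N) * ?F + (1 - p) * w N * (?F + f 1)) * colour_sum real s +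
     p * w (Suc N) * colour_sum (\<lambda>x. real x * (f (Suc x) - f x)) s +
     (1 - p) * w N * colour_sum (\<lambda>x. real x * (f (x - 1) - f x)) s"
    unfolding colour_sum_def[of "\<lambda>x. real x * _ x"] colour_sum_def[of real]
    by (simp add: sum_distrib_left sum.distrib[symmetric] algebra_simps)
  finally show ?thesis
    using num_balls_pos[OF assms(1)]
    unfolding num_balls_eq_colour_sum[OF assms(1), symmetric] N_def[symmetric]
    by (simp add: add_divide_distrib) (simp add: algebra_simps)
qed

lemma step_exp_sum:
  assumes "admissible s" "finite J"
  shows "step_exp p (\<lambda>s. \<Sum>j\<in>J. \<phi> j s) s = (\<Sum>j\<in>J. step_exp p (\<phi> j) s)"
  unfolding step_exp_def
  by (intro Bochner_Integration.integral_sum integrable_measure_pmf_finite finite_set_pmf_urn_step assms)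

lemma step_exp_add:
  assumes "admissible s"
  shows "step_exp p (\<lambda>s. \<phi> s + \<psi> s) s = step_exp p \<phi> s + step_exp p \<psi> s"
  unfolding step_exp_def
  by (intro Bochner_Integration.integral_add integrable_measure_pmf_finite finite_set_pmf_urn_step assms)

lemma step_exp_cmult: "step_exp p (\<lambda>s. a * \<phi> s) s = a * step_exp p \<phi> s"
  by (simp add: step_exp_def)

section \<open>Rising factorial moments and their one-step expectations\<close>

definition rising_moment :: "nat \<Rightarrow> urn_state \<Rightarrow> real" where
  "rising_moment j = colour_sum (\<lambda>x. pochhammer (real x) j)"

lemma pochhammer_real_nonneg: "0 \<le> pochhammer (real x) j"
  by (simp add: pochhammer_of_nat)

lemma rising_moment_nonneg: "0 \<le> rising_moment j s"
  unfolding rising_moment_def by (intro colour_sum_nonneg pochhammer_real_nonneg)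

text \<open>Moving one factor from the front to the end gives x *
  \<open>pochhammer (x + 1) j\<close> = \<open>pochhammer x j\<close> * (x + j).\<close>

lemma pochhammer_forward_difference:
  "real x * (pochhammer (real (Suc x)) j - pochhammer (real x) j) = real j * pochhammer (real x) j"
  using pochhammer_rec[of "real x" j] by (simp add: pochhammer_Suc algebra_simps)

text \<open>With x = y + 1, the rising factorials of order j at y and at x are y and x + j - 1 times
  that of order j - 1 at x; these two factors differ by j.\<close>

lemma pochhammer_backward_difference:
  assumes "1 \<le> j"
  shows "real x * (pochhammer (real (x - 1)) j - pochhammer (real x) j) =
    - real j * pochhammer (real x) j + real j * (real j - 1) * pochhammer (real x) (j - 1)"
proof (cases x)
  case 0
  then show ?thesis using assms by (cases "j = 1") (auto simp: pochhammer_0_left)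
next
  case (Suc y)
  obtain i where j: "j = Suc i" using assms by (cases j) auto
  have "pochhammer (real y) j = real y * pochhammer (real x) i"
    by (simp add: j Suc pochhammer_rec algebra_simps)
  moreover have "pochhammer (real x) j = pochhammer (real x) i * (real x + real i)"
    by (simp add: j pochhammer_Suc)
  ultimately show ?thesis
    by (simp add: j Suc algebra_simps)
qed

text \<open>The last summand \<open>fact j\<close> is the contribution of a newborn colour,
  \<open>pochhammer 1 j\<close>.\<close>

lemma step_exp_rising_moment:
  assumes "admissible s" "0 \<le> p" "p \<le> 1" "1 \<le> j"
  defines "N \<equiv> num_balls s"
  shows "step_exp p (\<lambda>s. w (num_balls s) * rising_moment j s) s =
    p * w (Suc N) * (1 + real j / N) * rising_moment j s +
    (1 - p) * w N * ((1 - real j / N) * rising_moment j s +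
      real j * (real j - 1) * rising_moment (j - 1) s / N + fact j)"
proof -
  have bwd: "colour_sum (\<lambda>x. real x * (pochhammer (real (x - 1)) j - pochhammer (real x) j)) s =
     - real j * rising_moment j s + real j * (real j - 1) * rising_moment (j - 1) s"
    unfolding pochhammer_backward_difference[OF assms(4)] rising_moment_def
    by (simp add: colour_sum_def sum_subtractf sum_distrib_left sum_negf)
  have fwd: "colour_sum (\<lambda>x. real x * (pochhammer (real (Suc x)) j - pochhammer (real x) j)) s =
     real j * rising_moment j s"
    unfolding pochhammer_forward_difference rising_moment_def by (rule colour_sum_cmult)
  show ?thesis
    unfolding rising_moment_def[of j] step_exp_colour_sum[OF assms(1-3), of w "\<lambda>x. pochhammer (real x) j"]
    unfolding bwd fwd rising_moment_def[of j, symmetric] N_def[symmetric]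
    by (simp add: pochhammer_fact[symmetric] algebra_simps add_divide_distrib diff_divide_distrib)
qed

text \<open>Low orders get the high powers of \<open>B\<close>, so that their decay can pay for
  higher orders. The order 0 is left out because it would count extinct colours; this makes the
  polynomial vanish at 0.\<close>

definition rising_poly :: "real \<Rightarrow> nat \<Rightarrow> nat \<Rightarrow> real" where
  "rising_poly B m x = (\<Sum>j=1..m. B ^ (m - j) * pochhammer (real x) j)"

lemma colour_sum_rising_poly:
  "colour_sum (rising_poly B m) s = (\<Sum>j=1..m. B ^ (m - j) * rising_moment j s)"
  unfolding colour_sum_def rising_poly_def rising_moment_def
  by (subst sum.swap) (simp add: sum_distrib_left)

section \<open>Drift of weighted moments in the supercritical regime\<close>

locale urn_parameter =
  fixes p :: real
  assumes half_less: "1 / 2 < p" and less_one: "p < 1"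
begin

lemma p_bounds: "0 \<le> p" "p \<le> 1" "0 < p"
  using half_less less_one by auto

definition q :: real where "q = 1 - p"

definition drift :: real where "drift = 2 * p - 1"

lemma q_bounds: "0 < q" "q \<le> 1" "q < p"
  using half_less less_one by (auto simp: q_def)

lemma drift_bounds: "0 < drift" "drift \<le> 1" "drift = p - q"
  using half_less less_one by (auto simp: drift_def q_def)

text \<open>A weight decaying at the rate for order \<open>m\<close> overcompensates the growth of a
  moment of lower order j; the excess is the negative term with \<open>m - j\<close>. The premise
  \<open>w\<close> is an inequality so that it covers both \<open>weight m\<close> and, for even
  \<open>m\<close>, the square of the weight of order m / 2.\<close>

lemma step_exp_rising_moment_le:
  assumes s: "admissible s" and j: "1 \<le> j" "j \<le> m"
  defines "N \<equiv> num_balls s"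
  assumes w: "p * w (Suc N) * (real N + real m) \<le> w N * (p * real N + q * real m)"
  shows "step_exp p (\<lambda>s. w (num_balls s) * rising_moment j s) s \<le> w N * (rising_moment j s
     - drift * real (m - j) / (N + m) * rising_moment j s
     + q * (real j * (real j - 1) * rising_moment (j - 1) s / N + fact j))"
proof -
  have N: "0 < real N" using num_balls_pos[OF s] by (simp add: N_def)
  have "p * w (Suc N) * (real N + real j) = p * w (Suc N) * (real N + real m) * ((real N + real j) / (real N + real m))"
    using N by (simp add: field_simps)
  also have "\<dots> \<le> w N * (p * real N + q * real m) * ((real N + real j) / (real N + real m))"
    using N by (intro mult_right_mono w) auto
  finally have chain: "p * w (Suc N) * (real N + real j) \<le>
      w N * (p * real N + q * real m) * ((real N + real j) / (real N + real m))" .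
  have "(p * real N + q * real m) * (real N + real j) =
      (p * real N + q * real j) * (real N + real m) - N * (drift * real (m - j))"
    using j by (simp add: drift_bounds(3) of_nat_diff algebra_simps)
  then have "(p * real N + q * real m) * ((real N + real j) / (real N + real m)) =
      ((p * real N + q * real j) * (real N + real m) - N * (drift * real (m - j))) / (real N + real m)"
    by simp
  also have "\<dots> = (p * real N + q * real j) - N * (drift * real (m - j)) / (real N + real m)"
    using N by (subst diff_divide_distrib, subst nonzero_mult_div_cancel_right) auto
  also have "\<dots> = N * (p + q * real j / N - drift * real (m - j) / (N + m))"
    using N by (simp add: distrib_left right_diff_distrib mult.commute)
  finally have wN: "w N * (p * real N + q * real m) * ((real N + real j) / (real N + real m)) =
      w N * (N * (p + q * real j / N - drift * real (m - j) / (N + m)))"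
    by (metis mult.assoc)
  have "p * w (Suc N) * (real N + real j) \<le> w N * (N * (p + q * real j / N - drift * real (m - j) / (N + m)))"
    using chain wN by linarith
  then have "p * w (Suc N) * (1 + real j / N) \<le> w N * (p + q * real j / N - drift * real (m - j) / (N + m))"
    using N by (simp add: field_simps)
  then have "p * w (Suc N) * (1 + real j / N) * rising_moment j s \<le>
      w N * (p + q * real j / N - drift * real (m - j) / (N + m)) * rising_moment j s"
    by (intro mult_right_mono rising_moment_nonneg)
  then show ?thesis
    unfolding step_exp_rising_moment[OF s p_bounds(1,2) j(1)] N_def[symmetric] q_def
    by (simp add: algebra_simps)
qed

lemma step_exp_rising_moment_exact:
  assumes s: "admissible s" and k: "1 \<le> k"
  defines "N \<equiv> num_balls s"
  assumes w: "p * w (Suc N) * (real N + real k) = w N * (p * real N + q * real k)"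
  shows "step_exp p (\<lambda>s. w (num_balls s) * rising_moment k s) s = w N * (rising_moment k s
     + q * (real k * (real k - 1) * rising_moment (k - 1) s / N + fact k))"
proof -
  have N: "0 < real N" using num_balls_pos[OF s] by (simp add: N_def)
  have "p * w (Suc N) * (1 + real k / N) = w N * (p + q * real k / N)"
    using N w by (simp add: field_simps)
  then show ?thesis
    unfolding step_exp_rising_moment[OF s p_bounds(1,2) k(1)] N_def[symmetric] q_def
    by (simp add: algebra_simps)
qed

text \<open>
  The powers of this base in \<^const>\<open>rising_poly\<close> grow fast enough that the negative drift of each rising
  moment below the top one absorbs the term which the next higher moment contributes to it, with a
  surplus \<open>D\<close> at order \<open>m - 1\<close>.
\<close>

definition lyapunov_base :: "nat \<Rightarrow> real \<Rightarrow> real" where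
  "lyapunov_base m D = (1 + real m) * (real m ^ 2 + D) / drift"

lemma lyapunov_base_ge_1:
  assumes "1 \<le> m" "0 \<le> D" shows "1 \<le> lyapunov_base m D"
proof -
  have "1 \<le> real m" using assms by simp
  then have "1 \<le> real m ^ 2 + D" using assms by (simp add: one_le_power add_increasing2)
  then have "1 * 1 \<le> (1 + real m) * (real m ^ 2 + D)" by (intro mult_mono) auto
  then show ?thesis using drift_bounds by (simp add: lyapunov_base_def field_simps)
qed

text \<open>Order j feeds a multiple of the moment of order j - 1 into the drift, while the negative
  drift of order j - 1 carries one more power of the base. Comparing coefficients order by order
  leaves only the births, collected in \<open>h 1\<close>, and the surplus.\<close>

lemma step_exp_rising_poly_le:
  assumes s: "admissible s" and m: "2 \<le> m" and D: "0 \<le> D" and w0: "0 \<le> w (num_balls s)"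
  defines "N \<equiv> num_balls s" and "h \<equiv> rising_poly (lyapunov_base m D) m"
  assumes w: "p * w (Suc N) * (real N + real m) \<le> w N * (p * real N + q * real m)"
  shows "step_exp p (\<lambda>s. w (num_balls s) * colour_sum h s) s \<le>
    w N * (colour_sum h s + q * h 1 - D * rising_moment (m - 1) s / N)"
proof -
  define B where "B = lyapunov_base m D"
  have B: "1 \<le> B" unfolding B_def using m D by (intro lyapunov_base_ge_1) auto
  have N: "1 \<le> real N" using num_balls_pos[OF s] by (simp add: N_def)
  let ?S = "\<lambda>j. rising_moment j s"
  let ?E1 = "\<Sum>j=1..m. - (B ^ (m - j) * (drift * real (m - j) / (N + m))) * ?S j"
  let ?E2 = "\<Sum>j=1..m. B ^ (m - j) * (q * real j * (real j - 1) * ?S (j - 1) / N)"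
  have "step_exp p (\<lambda>s. w (num_balls s) * colour_sum h s) s =
     (\<Sum>j=1..m. B ^ (m - j) * step_exp p (\<lambda>s. w (num_balls s) * rising_moment j s) s)"
    unfolding h_def colour_sum_rising_poly B_def[symmetric] sum_distrib_left
    by (subst step_exp_sum[OF s]) (simp_all add: step_exp_cmult[symmetric] mult.left_commute)
  also have "\<dots> \<le> (\<Sum>j=1..m. B ^ (m - j) * (w N * (?S j - drift * real (m - j) / (N + m) * ?S j
     + q * (real j * (real j - 1) * ?S (j - 1) / N + fact j))))"
    using B w unfolding N_def
    by (intro sum_mono mult_left_mono step_exp_rising_moment_le s) auto
  also have "\<dots> = w N * ((\<Sum>j=1..m. B ^ (m - j) * ?S j) + q * (\<Sum>j=1..m. B ^ (m - j) * fact j)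
     + ((\<Sum>j=1..m. - (B ^ (m - j) * (drift * real (m - j) / (N + m))) * ?S j) +
        (\<Sum>j=1..m. B ^ (m - j) * (q * real j * (real j - 1) * ?S (j - 1) / N))))"
    unfolding sum_distrib_left sum.distrib[symmetric]
    by (intro sum.cong) (simp_all add: algebra_simps)
  also have "(\<Sum>j=1..m. B ^ (m - j) * fact j) = h 1"
    by (simp add: h_def rising_poly_def B_def pochhammer_fact)
  also have "(\<Sum>j=1..m. B ^ (m - j) * ?S j) = colour_sum h s"
    by (simp add: h_def colour_sum_rising_poly B_def)
  finally have step: "step_exp p (\<lambda>s. w (num_balls s) * colour_sum h s) s \<le>
      w N * (colour_sum h s + q * h 1 + (?E1 + ?E2))" .
  have "?E2 =
      (\<Sum>i<m. B ^ (m - Suc i) * (q * real (Suc i) * real i * ?S i / N))"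
    by (rule sum.reindex_bij_witness[of _ Suc "\<lambda>j. j - 1"]) (auto simp: of_nat_diff)
  \<comment> \<open>The order j = 1 contributes nothing because of its factor j - 1, so after the
    shift no moment of order 0 appears.\<close>
  also have "\<dots> = (\<Sum>i=1..<m. B ^ (m - Suc i) * (q * real (Suc i) * real i * ?S i / N))"
    by (rule sum.mono_neutral_right) (auto simp: not_le Suc_le_eq)
  finally have E2: "?E2 = (\<Sum>i=1..<m. B ^ (m - Suc i) * (q * real (Suc i) * real i * ?S i / N))" .
  have E1: "?E1 = (\<Sum>j=1..<m. - (B ^ (m - j) * (drift * real (m - j) / (N + m))) * ?S j)"
    by (rule sum.mono_neutral_right) auto
  have "?E1 + ?E2 =
      (\<Sum>i=1..<m. (B ^ (m - Suc i) * (q * real (Suc i) * real i / N)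
         - B ^ (m - i) * (drift * real (m - i) / (N + m))) * ?S i)"
    unfolding E1 E2 by (simp add: sum.distrib[symmetric] algebra_simps)
  also have "\<dots> \<le> (\<Sum>i=1..<m. - (B ^ (m - Suc i) * D / N) * ?S i)"
  proof (intro sum_mono mult_right_mono rising_moment_nonneg)
    fix i assume i: "i \<in> {1..<m}"
    have "q * (real (Suc i) * real i) \<le> 1 * (real m * real m)"
      using i q_bounds by (intro mult_mono) auto
    then have qi: "q * real (Suc i) * real i \<le> real m ^ 2" by (simp add: power2_eq_square mult.assoc)
    \<comment> \<open>Since N >= 1, N + m <= (1 + m) N; this is where the factor 1 + m of
      \<open>lyapunov_base\<close> comes from.\<close>
    have "(real m ^ 2 + D) / N = (1 + real m) * (real m ^ 2 + D) / ((1 + real m) * N)"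
      by (subst mult_divide_mult_cancel_left) auto
    also have "\<dots> \<le> (1 + real m) * (real m ^ 2 + D) / (N + real m)"
      using N D by (intro divide_left_mono mult_pos_pos) (auto simp: distrib_right mult_le_cancel_left1)
    also have "\<dots> = B * drift / (N + m)"
      using drift_bounds by (simp add: B_def lyapunov_base_def)
    also have "\<dots> \<le> B * (drift * real (m - i)) / (N + m)"
      using B drift_bounds i by (intro divide_right_mono mult_left_mono) auto
    finally have key: "(real m ^ 2 + D) / N \<le> B * (drift * real (m - i)) / (N + m)" .
    have "q * real (Suc i) * real i / N + D / N \<le> (real m ^ 2 + D) / N"
      using qi N by (simp add: add_divide_distrib[symmetric] divide_right_mono)
    with key have "q * real (Suc i) * real i / N - B * (drift * real (m - i)) / (N + m) \<le> - (D / N)"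
      by linarith
    then have "B ^ (m - Suc i) * (q * real (Suc i) * real i / N - B * (drift * real (m - i)) / (N + m))
       \<le> B ^ (m - Suc i) * (- (D / N))"
      using B by (intro mult_left_mono) auto
    moreover have "B ^ (m - i) = B ^ (m - Suc i) * B"
      using i by (metis Suc_diff_Suc atLeastLessThan_iff power_Suc2)
    ultimately show "B ^ (m - Suc i) * (q * real (Suc i) * real i / N)
         - B ^ (m - i) * (drift * real (m - i) / (N + m)) \<le> - (B ^ (m - Suc i) * D / N)"
      by (simp add: algebra_simps)
  qed
  \<comment> \<open>All summands are nonpositive; only the one of order m - 1, with coefficient B ^
    0, is kept as the surplus.\<close>
  also have "\<dots> \<le> (\<Sum>i\<in>{m - 1}. - (B ^ (m - Suc i) * D / N) * ?S i)"
  proof -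
    have "(\<Sum>i\<in>{m - 1}. (B ^ (m - Suc i) * D / N) * ?S i) \<le> (\<Sum>i=1..<m. (B ^ (m - Suc i) * D / N) * ?S i)"
      using m B D N by (intro sum_mono2) (auto intro!: mult_nonneg_nonneg divide_nonneg_nonneg rising_moment_nonneg)
    then show ?thesis by (simp only: minus_mult_left[symmetric] sum_negf neg_le_iff_le)
  qed
  also have "\<dots> = - (D * ?S (m - 1) / N)" using m by simp
  finally have "colour_sum h s + q * h 1 + (?E1 + ?E2) \<le> colour_sum h s + q * h 1 - D * ?S (m - 1) / N"
    by simp
  then have "w N * (colour_sum h s + q * h 1 + (?E1 + ?E2)) \<le>
      w N * (colour_sum h s + q * h 1 - D * ?S (m - 1) / N)"
    using w0 unfolding N_def by (rule mult_left_mono)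
  with step show ?thesis by linarith
qed

end

section \<open>The scaled moments and their majorants\<close>

lemma pochhammer_mono2:
  fixes z z' :: real
  assumes "1 \<le> z" "z \<le> z'" "i \<le> i'"
  shows "pochhammer z i \<le> pochhammer z' i'"
proof -
  have "pochhammer z i \<le> pochhammer z' i"
    unfolding pochhammer_prod using assms by (intro prod_mono) auto
  also have "pochhammer z' i' = pochhammer z' i * pochhammer (z' + real i) (i' - i)"
    using assms(3) by (rule pochhammer_product)
  have "1 \<le> pochhammer (z' + real i) (i' - i)"
    unfolding pochhammer_prod using assms by (intro prod_ge_1) auto
  then have "pochhammer z' i * 1 \<le> pochhammer z' i'"
    unfolding \<open>pochhammer z' i' = _\<close> using assms by (intro mult_left_mono pochhammer_nonneg) auto
  finally show ?thesis by simp
qed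

lemma pochhammer_cmult_le:
  fixes z c :: real
  assumes "1 \<le> c" "0 \<le> z"
  shows "pochhammer (c * z) k \<le> c ^ k * pochhammer z k"
proof -
  have "pochhammer (c * z) k \<le> (\<Prod>i = 0..<k. c * (z + real i))"
    unfolding pochhammer_prod
    using assms by (intro prod_mono) (auto simp: distrib_left mult_le_cancel_right1)
  then show ?thesis by (simp add: prod.distrib pochhammer_prod)
qed

lemma pochhammer_Suc_diff:
  "pochhammer (real (Suc y)) (Suc i) - pochhammer (real y) (Suc i) =
    real (Suc i) * pochhammer (real (Suc y)) i"
  unfolding pochhammer_rec[of "real y" i] by (simp add: pochhammer_Suc algebra_simps)

text \<open>The factor j arises from differencing a rising factorial of order j. Being at least 1,
  it makes the same constant bound both the values and the increments of
  \<open>rising_poly\<close>.\<close>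

definition rising_const :: "real \<Rightarrow> nat \<Rightarrow> real" where
  "rising_const B m = (\<Sum>j=1..m. real j * B ^ (m - j))"

lemma rising_poly_0: "rising_poly B m 0 = 0"
  by (auto simp: rising_poly_def pochhammer_0_left)

lemma rising_poly_le:
  assumes "0 \<le> B"
  shows "rising_poly B m x \<le> rising_const B m * pochhammer (real x) m"
proof (cases "x = 0")
  case True
  then show ?thesis using assms pochhammer_real_nonneg[of 0 m]
    by (auto simp: rising_poly_0 rising_const_def intro!: mult_nonneg_nonneg sum_nonneg)
next
  case False
  have "rising_poly B m x \<le> (\<Sum>j=1..m. (real j * B ^ (m - j)) * pochhammer (real x) m)"
    unfolding rising_poly_def
  proof (rule sum_mono, rule mult_mono)
    fix j assume j: "j \<in> {1..m}"
    then have "1 * B ^ (m - j) \<le> real j * B ^ (m - j)"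
      using assms by (intro mult_right_mono) auto
    then show "B ^ (m - j) \<le> real j * B ^ (m - j)" by simp
    show "pochhammer (real x) j \<le> pochhammer (real x) m"
      using False j by (intro pochhammer_mono2) auto
  qed (use assms pochhammer_real_nonneg in auto)
  then show ?thesis by (simp add: rising_const_def sum_distrib_right)
qed

lemma rising_poly_ge:
  assumes "0 \<le> B" "1 \<le> m"
  shows "pochhammer (real x) m \<le> rising_poly B m x"
proof -
  have "(\<Sum>j\<in>{m}. B ^ (m - j) * pochhammer (real x) j) \<le> rising_poly B m x"
    unfolding rising_poly_def using assms pochhammer_real_nonneg
    by (intro sum_mono2) auto
  then show ?thesis by simp
qed

text \<open>The freedom y <= x lets one bound at the drawn count x serve all changes: copying (y =
  x), loss of a ball (y = x - 1) and birth of a colour (y = 0).\<close>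

lemma rising_poly_diff:
  assumes "0 \<le> B" "y \<le> x"
  shows "0 \<le> rising_poly B m (Suc y) - rising_poly B m y"
    and "rising_poly B m (Suc y) - rising_poly B m y \<le>
      rising_const B m * pochhammer (real (Suc x)) (m - 1)"
proof -
  have eq: "rising_poly B m (Suc y) - rising_poly B m y =
      (\<Sum>j=1..m. (real j * B ^ (m - j)) * pochhammer (real (Suc y)) (j - 1))"
    unfolding rising_poly_def sum_subtractf[symmetric]
  proof (rule sum.cong)
    fix j assume "j \<in> {1..m}"
    then obtain i where "j = Suc i" by (cases j) auto
    then show "B ^ (m - j) * pochhammer (real (Suc y)) j - B ^ (m - j) * pochhammer (real y) j =
         real j * B ^ (m - j) * pochhammer (real (Suc y)) (j - 1)"
      using pochhammer_Suc_diff[of y i] by (simp add: right_diff_distrib[symmetric])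
  qed simp
  show "0 \<le> rising_poly B m (Suc y) - rising_poly B m y"
    unfolding eq using assms by (intro sum_nonneg mult_nonneg_nonneg pochhammer_nonneg) auto
  show "rising_poly B m (Suc y) - rising_poly B m y \<le>
      rising_const B m * pochhammer (real (Suc x)) (m - 1)"
    unfolding eq rising_const_def sum_distrib_right
    using assms by (intro sum_mono mult_left_mono pochhammer_mono2) auto
qed

lemma rising_const_nonneg: "0 \<le> B \<Longrightarrow> 0 \<le> rising_const B m"
  by (auto simp: rising_const_def intro!: sum_nonneg)

text \<open>The right side consists of x, the k - 1 factors from x + 1 on, and k - 1 further factors
  which are larger. The order 2 k - 1 is the one at which \<open>step_exp_rising_poly_le\<close>
  with m = 2 k leaves its surplus.\<close>

lemma square_pochhammer_le:
  assumes "1 \<le> k"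
  shows "real x * pochhammer (real (Suc x)) (k - 1) ^ 2 \<le> pochhammer (real x) (2 * k - 1)"
proof -
  have "2 * k - 1 = Suc ((k - 1) + (k - 1))" using assms by simp
  then have "pochhammer (real x) (2 * k - 1) = real x * (pochhammer (real (Suc x)) (k - 1) *
      pochhammer (real (Suc x) + real (k - 1)) (k - 1))"
    by (simp only: pochhammer_rec pochhammer_product') (simp add: add.commute)
  moreover have "pochhammer (real (Suc x)) (k - 1) \<le> pochhammer (real (Suc x) + real (k - 1)) (k - 1)"
    by (intro pochhammer_mono2) auto
  ultimately show ?thesis
    by (auto simp: power2_eq_square intro!: mult_left_mono pochhammer_nonneg)
qed

text \<open>Cauchy-Schwarz after splitting off one square root of the count; the first factor then
  sums to N.\<close>

lemma rising_moment_square_le: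
  assumes s: "admissible s" and k: "1 \<le> k"
  shows "rising_moment k s ^ 2 \<le> real (num_balls s) * rising_moment (2 * k - 1) s"
proof -
  let ?x = "\<lambda>c. count (snd s) c"
  let ?a = "\<lambda>c. sqrt (real (?x c))"
  let ?b = "\<lambda>c. sqrt (real (?x c)) * pochhammer (real (Suc (?x c))) (k - 1)"
  have "k = Suc (k - 1)" using k by simp
  then have "pochhammer (real x) k = real x * pochhammer (real (Suc x)) (k - 1)" for x
    by (metis pochhammer_rec of_nat_Suc add.commute)
  then have "rising_moment k s = (\<Sum>c<fst s. ?a c * ?b c)"
    by (simp add: rising_moment_def colour_sum_def mult.assoc[symmetric])
  then have "rising_moment k s ^ 2 \<le> (\<Sum>c<fst s. ?a c ^ 2) * (\<Sum>c<fst s. ?b c ^ 2)"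
    by (simp only: Cauchy_Schwarz_ineq_sum)
  also have "(\<Sum>c<fst s. ?a c ^ 2) = real (num_balls s)"
    unfolding num_balls_eq_colour_sum[OF s] by (simp add: colour_sum_def)
  also have "(\<Sum>c<fst s. ?b c ^ 2) \<le> rising_moment (2 * k - 1) s"
    unfolding rising_moment_def colour_sum_def
    using square_pochhammer_le[OF k] by (intro sum_mono) (simp add: power_mult_distrib)
  then have "real (num_balls s) * (\<Sum>c<fst s. ?b c ^ 2) \<le> real (num_balls s) * rising_moment (2 * k - 1) s"
    by (intro mult_left_mono) auto
  finally show ?thesis .
qed

lemma num_balls_le_rising_moment:
  assumes "admissible s" "1 \<le> k"
  shows "real (num_balls s) \<le> rising_moment k s"
  unfolding num_balls_eq_colour_sum[OF assms(1)] rising_moment_def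
proof (rule colour_sum_mono)
  fix x show "real x \<le> pochhammer (real x) k"
    using assms(2) pochhammer_mono2[of "real x" "real x" 1 k]
    by (cases "x = 0") (auto simp: pochhammer_0_left)
qed

text \<open>For x >= 1, x + k <= (k + 1) x, so the upper half of the factors costs only a constant,
  and a sum of squares of nonnegative terms is at most the square of their sum. This is what makes
  the second-order majorant comparable to a square uniformly in the state.\<close>

lemma rising_moment_double_le:
  assumes "1 \<le> k"
  shows "rising_moment (2 * k) s \<le> (real k + 1) ^ k * rising_moment k s ^ 2"
proof -
  let ?a = "\<lambda>c. pochhammer (real (count (snd s) c)) k"
  have le: "pochhammer (real x) (2 * k) \<le> (real k + 1) ^ k * (pochhammer (real x) k * pochhammer (real x) k)" for x
  proof (cases "x = 0")
    case False
    then have "real x + real k \<le> (real k + 1) * real x"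
      by (simp add: distrib_right mult_le_cancel_left1)
    then have "pochhammer (real x + real k) k \<le> pochhammer ((real k + 1) * real x) k"
      using False by (intro pochhammer_mono2) auto
    also have "\<dots> \<le> (real k + 1) ^ k * pochhammer (real x) k"
      by (rule pochhammer_cmult_le) auto
    finally have "pochhammer (real x) k * pochhammer (real x + real k) k \<le>
        pochhammer (real x) k * ((real k + 1) ^ k * pochhammer (real x) k)"
      by (intro mult_left_mono pochhammer_real_nonneg)
    then show ?thesis
      unfolding mult_2 pochhammer_product' by (simp only: mult_ac)
  qed (use assms in \<open>auto simp: pochhammer_0_left\<close>)
  have "rising_moment (2 * k) s \<le> (\<Sum>c<fst s. (real k + 1) ^ k * (?a c * ?a c))"
    unfolding rising_moment_def colour_sum_def by (intro sum_mono le)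
  also have "\<dots> \<le> (\<Sum>c<fst s. (real k + 1) ^ k * (?a c * rising_moment k s))"
    unfolding rising_moment_def colour_sum_def
    by (intro sum_mono mult_left_mono pochhammer_real_nonneg member_le_sum) auto
  also have "\<dots> = (real k + 1) ^ k * (rising_moment k s * rising_moment k s)"
    unfolding sum_distrib_left[symmetric] sum_distrib_right[symmetric]
    by (simp add: rising_moment_def colour_sum_def)
  finally show ?thesis by (simp add: power2_eq_square)
qed

lemma colour_sum_rising_poly_bounds:
  assumes "0 \<le> B" "1 \<le> m"
  shows "colour_sum (rising_poly B m) s \<le> rising_const B m * rising_moment m s"
    and "rising_moment m s \<le> colour_sum (rising_poly B m) s"
  unfolding rising_moment_def colour_sum_cmult[symmetric]
  by (intro colour_sum_mono rising_poly_le rising_poly_ge assms)+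

lemma sum3_square_le: "(a + b + c :: real) ^ 2 \<le> 3 * (a ^ 2 + b ^ 2 + c ^ 2)"
proof -
  have "0 \<le> (a - b) ^ 2 + (b - c) ^ 2 + (a - c) ^ 2" by simp
  then show ?thesis by (simp add: power2_eq_square algebra_simps)
qed

section \<open>The weights, their decay and their tail sums\<close>

context urn_parameter
begin

text \<open>
  The solution of \<open>weight_rec\<close>, the recursion under which the leading term of the drift of
  \<open>weight k N * rising_moment k\<close> vanishes identically.
\<close>

definition weight :: "nat \<Rightarrow> nat \<Rightarrow> real" where
  "weight k n = pochhammer (real k * q / p) n / pochhammer (real k) n"

lemma weight_pos: "1 \<le> k \<Longrightarrow> 0 < weight k n"
  using p_bounds q_bounds by (auto simp: weight_def intro!: divide_pos_pos pochhammer_pos)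

lemma weight_Suc:
  assumes "1 \<le> k"
  shows "weight k (Suc n) = weight k n * ((p * real n + q * real k) / (p * (real n + real k)))"
  using p_bounds by (simp add: weight_def pochhammer_Suc field_simps)

lemma weight_rec:
  assumes "1 \<le> k"
  shows "p * weight k (Suc n) * (real n + real k) = weight k n * (p * real n + q * real k)"
  using p_bounds assms by (simp add: weight_Suc)

text \<open>After clearing denominators, the difference of the two sides is a polynomial whose terms
  are nonnegative because q < p. The result is the premise \<open>w\<close> of
  \<open>step_exp_rising_poly_le\<close> for the squared weight and m = 2 k.\<close>

lemma weight_square_rec:
  assumes k: "1 \<le> k"
  shows "p * weight k (Suc n) ^ 2 * (real n + real (2 * k)) \<le>
    weight k n ^ 2 * (p * real n + q * real (2 * k))"
proof -
  define N K where "N = real n" and "K = real k"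
  have pos: "0 \<le> N" "1 \<le> K" using k by (auto simp: N_def K_def)
  have "0 \<le> K ^ 2 * N * (p - q) * (p + q) + 2 * K ^ 3 * (q * (p - q))"
    using pos p_bounds q_bounds by (intro add_nonneg_nonneg mult_nonneg_nonneg) auto
  also have "\<dots> = p * (p * N + q * (2 * K)) * (N + K) ^ 2 - (p * N + q * K) ^ 2 * (N + 2 * K)"
    by (simp add: power2_eq_square power3_eq_cube algebra_simps)
  finally have key: "(p * N + q * K) ^ 2 * (N + 2 * K) \<le> p * (p * N + q * (2 * K)) * (N + K) ^ 2"
    by simp
  define R where "R = (p * N + q * K) / (p * (N + K))"
  have R: "p * R ^ 2 = (p * N + q * K) ^ 2 / (p * (N + K) ^ 2)"
    using p_bounds by (simp add: R_def power_divide power_mult_distrib power2_eq_square)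
  have "p * weight k (Suc n) ^ 2 * (N + 2 * K) = weight k n ^ 2 * ((p * R ^ 2) * (N + 2 * K))"
    using k by (simp add: weight_Suc N_def[symmetric] K_def[symmetric] R_def[symmetric] power_mult_distrib)
  also have "\<dots> = weight k n ^ 2 * ((p * N + q * K) ^ 2 * (N + 2 * K) / (p * (N + K) ^ 2))"
    unfolding R by simp
  also have "\<dots> \<le> weight k n ^ 2 * (p * (p * N + q * (2 * K)) * (N + K) ^ 2 / (p * (N + K) ^ 2))"
    using p_bounds by (intro mult_left_mono divide_right_mono key) auto
  also have "\<dots> = weight k n ^ 2 * (p * N + q * (2 * K))"
  proof -
    have "0 < N + K" using pos by simp
    then show ?thesis using p_bounds by simp
  qed
  finally show ?thesis by (simp add: N_def K_def)
qed

lemma weight_diff: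
  assumes "1 \<le> k" "1 \<le> n"
  shows "weight k (Suc n) \<le> weight k n"
    and "weight k n - weight k (Suc n) \<le> weight k n * (real k / real n)"
proof -
  have pos: "0 < real n + real k" using assms by simp
  have nz: "p * (real n + real k) \<noteq> 0" using pos p_bounds by simp
  have "p * real n + q * real k = p * (real n + real k) - real k * (p - q)" by (simp add: algebra_simps)
  then have "(p * real n + q * real k) / (p * (real n + real k)) = 1 - real k * (p - q) / (p * (real n + real k))"
    by (simp only: diff_divide_distrib divide_self[OF nz])
  then have eq: "weight k n - weight k (Suc n) = weight k n * (real k * (p - q) / (p * (real n + real k)))"
    using assms by (simp add: weight_Suc right_diff_distrib)
  have "0 \<le> weight k n * (real k * (p - q) / (p * (real n + real k)))"
    using weight_pos[OF assms(1), of n] p_bounds q_bounds pos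
    by (intro mult_nonneg_nonneg divide_nonneg_nonneg) auto
  with eq show "weight k (Suc n) \<le> weight k n" by linarith
  have "real k * (p - q) / (p * (real n + real k)) \<le> real k * p / (p * (real n + real k))"
    using p_bounds q_bounds pos by (intro divide_right_mono mult_left_mono) auto
  also have "\<dots> = real k / (real n + real k)" using p_bounds by simp
  also have "\<dots> \<le> real k / real n" using assms by (intro divide_left_mono) auto
  finally show "weight k n - weight k (Suc n) \<le> weight k n * (real k / real n)"
    unfolding eq using weight_pos[OF assms(1), of n] by (intro mult_left_mono) auto
qed

text \<open>
  A closed form of \<open>(\<Sum>m\<ge>n. weight k m) / p\<close>, which exists because \<^const>\<open>weight\<close> is a quotient of Gamma
  functions. It pays for the newly born colours.
\<close>

definition weight_tail :: "nat \<Rightarrow> nat \<Rightarrow> real" where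
  "weight_tail k n = (real n + real k - 1) * weight k n / (real k * drift - p)"

text \<open>The recursion is hypergeometric and summable in closed form: the differences of (n + k -
  1) * \<open>weight k n\<close> are proportional to \<open>weight k n\<close>. The proportionality
  factor has the sign of \<open>k * drift - p\<close>, hence the condition on
  \<open>k\<close>.\<close>

lemma weight_tail_diff:
  assumes "1 \<le> k" "p < real k * drift"
  shows "weight_tail k n - weight_tail k (Suc n) = weight k n / p"
proof -
  define e where "e = real k * drift - p"
  have e: "0 < e" using assms by (simp add: e_def)
  have pos: "0 < real n + real k" using assms by simp
  define R where "R = (p * real n + q * real k) / (p * (real n + real k))"
  have "weight_tail k n - weight_tail k (Suc n) =
     weight k n * ((real n + real k - 1) - (real n + real k) * R) / e"
    unfolding weight_tail_def e_def[symmetric] weight_Suc[OF assms(1)] R_def[symmetric]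
    by (simp add: diff_divide_distrib[symmetric]) (simp add: algebra_simps)
  also have "(real n + real k) * R = (p * real n + q * real k) / p"
    using pos by (simp add: R_def)
  also have "(real n + real k - 1) - (p * real n + q * real k) / p = e / p"
    using p_bounds by (simp add: e_def drift_bounds(3) field_simps)
  finally show ?thesis using e by simp
qed

lemma weight_tail_bounds:
  assumes "1 \<le> k" "p < real k * drift" "1 \<le> n"
  shows "0 \<le> weight_tail k n" "weight_tail k n \<le> real k / (real k * drift - p) * (real n * weight k n)"
proof -
  show "0 \<le> weight_tail k n"
    unfolding weight_tail_def using assms weight_pos[OF assms(1), of n]
    by (intro divide_nonneg_nonneg mult_nonneg_nonneg) auto
  have "0 \<le> (real k - 1) * (real n - 1)" using assms by (intro mult_nonneg_nonneg) auto
  then have "real n + real k - 1 \<le> real k * real n" by (simp add: algebra_simps)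
  then have "weight_tail k n \<le> (real k * real n) * weight k n / (real k * drift - p)"
    unfolding weight_tail_def using assms weight_pos[OF assms(1), of n]
    by (intro divide_right_mono mult_right_mono) auto
  then show "weight_tail k n \<le> real k / (real k * drift - p) * (real n * weight k n)"
    by (simp add: mult_ac)
qed

section \<open>The moment submartingales and their comparable supermartingales\<close>

definition scaled_moment :: "nat \<Rightarrow> urn_state \<Rightarrow> real" where
  "scaled_moment k s = weight k (num_balls s) * rising_moment k s"

text \<open>The weight cancels the multiplicative part of the drift exactly; lower moments and
  births can only add to it.\<close>

lemma scaled_moment_submartingale:
  assumes "admissible s" "1 \<le> k"
  shows "scaled_moment k s \<le> step_exp p (scaled_moment k) s"
proof -
  have "step_exp p (scaled_moment k) s = weight k (num_balls s) * (rising_moment k s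
     + q * (real k * (real k - 1) * rising_moment (k - 1) s / num_balls s + fact k))"
    unfolding scaled_moment_def using assms weight_rec[OF assms(2)]
    by (intro step_exp_rising_moment_exact) auto
  moreover have "0 \<le> weight k (num_balls s) *
      (q * (real k * (real k - 1) * rising_moment (k - 1) s / num_balls s + fact k))"
    using assms q_bounds rising_moment_nonneg weight_pos[OF assms(2), of "num_balls s"]
    by (intro mult_nonneg_nonneg add_nonneg_nonneg divide_nonneg_nonneg) auto
  ultimately show ?thesis
    unfolding scaled_moment_def distrib_left by linarith
qed

lemma scaled_moment_pos:
  assumes "admissible s" "1 \<le> k"
  shows "0 < scaled_moment k s"
  using weight_pos[OF assms(2)] num_balls_le_rising_moment[OF assms] num_balls_pos[OF assms(1)]
  by (auto simp: scaled_moment_def intro!: mult_pos_pos)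

definition majorant_poly :: "nat \<Rightarrow> nat \<Rightarrow> real" where
  "majorant_poly k = rising_poly (lyapunov_base k 0) k"

text \<open>A supermartingale comparable to \<^const>\<open>scaled_moment\<close>.\<close>

definition majorant :: "nat \<Rightarrow> urn_state \<Rightarrow> real" where
  "majorant k s = weight k (num_balls s) * colour_sum (majorant_poly k) s + q * majorant_poly k 1 * weight_tail k (num_balls s)"

definition majorant_const :: "nat \<Rightarrow> real" where
  "majorant_const k = rising_const (lyapunov_base k 0) k"

text \<open>The three squares account for the change of the colour counts, of the weight and of the
  tail in one step; the factor 3 is that of \<open>sum3_square_le\<close>.\<close>

definition increment_const :: "nat \<Rightarrow> real" where
  "increment_const k = 3 * (majorant_const k ^ 2 + (real k * majorant_const k) ^ 2 + (q * majorant_poly k 1 / p) ^ 2)"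

definition square_poly :: "nat \<Rightarrow> nat \<Rightarrow> real" where
  "square_poly k = rising_poly (lyapunov_base (2 * k) (increment_const k)) (2 * k)"

text \<open>
  The square of a nonnegative supermartingale drifts upwards at most by its conditional quadratic
  variation; the second and third summand compensate for the latter.
\<close>

definition square_majorant :: "nat \<Rightarrow> urn_state \<Rightarrow> real" where
  "square_majorant k s = majorant k s ^ 2 + (weight k (num_balls s) ^ 2 * colour_sum (square_poly k) s
     + q * square_poly k 1 * (weight k (num_balls s) * weight_tail k (num_balls s)))"

context
  fixes k :: nat
  assumes k: "2 \<le> k" "p < real k * drift"
begin

lemma one_le_k: "1 \<le> k" using k by simp

lemma base_nonneg: "0 \<le> lyapunov_base k 0"
  using lyapunov_base_ge_1[OF one_le_k, of 0] by simp

lemma majorant_poly_1_nonneg: "0 \<le> majorant_poly k 1"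
  using rising_poly_ge[OF base_nonneg one_le_k, of 1] pochhammer_real_nonneg[of 1 k] unfolding majorant_poly_def by linarith

text \<open>The tail changes only when N grows, with probability p, and then falls by
  \<open>weight / p\<close>. Its mean loss is therefore the weight itself, which pays exactly for
  the birth term.\<close>

lemma majorant_supermartingale:
  assumes s: "admissible s"
  shows "step_exp p (majorant k) s \<le> majorant k s"
proof -
  let ?N = "num_balls s" and ?C = "q * majorant_poly k 1"
  have 1: "step_exp p (majorant k) s =
      step_exp p (\<lambda>s. weight k (num_balls s) * colour_sum (majorant_poly k) s) s
      + ?C * (p * weight_tail k (Suc ?N) + (1 - p) * weight_tail k ?N)"
    unfolding majorant_def
    by (simp add: step_exp_add[OF s] step_exp_cmult step_exp_num_balls[OF s p_bounds(1,2), where w = "weight_tail k"])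
  have 2: "step_exp p (\<lambda>s. weight k (num_balls s) * colour_sum (majorant_poly k) s) s \<le>
      weight k ?N * (colour_sum (majorant_poly k) s + ?C - 0 * rising_moment (k - 1) s / ?N)"
    unfolding majorant_poly_def using weight_pos[OF one_le_k] weight_rec[OF one_le_k] k
    by (intro step_exp_rising_poly_le s) (auto intro: less_imp_le)
  have 3: "p * weight_tail k (Suc ?N) + (1 - p) * weight_tail k ?N = weight_tail k ?N - weight k ?N"
  proof -
    have "p * (weight_tail k ?N - weight_tail k (Suc ?N)) = weight k ?N"
      using weight_tail_diff[OF one_le_k k(2)] p_bounds by simp
    then show ?thesis by (simp add: algebra_simps)
  qed
  have "step_exp p (majorant k) s \<le>
      weight k ?N * (colour_sum (majorant_poly k) s + ?C) + ?C * (weight_tail k ?N - weight k ?N)"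
    using 1 2 unfolding 3 by simp
  then show ?thesis by (simp add: majorant_def algebra_simps)
qed

text \<open>The tail is at most a constant times N times the weight, and N is at most the moment of
  order \<open>k\<close>, so the correction stays within a constant factor of
  \<open>scaled_moment\<close>.\<close>

lemma majorant_bounds:
  assumes s: "admissible s"
  shows "scaled_moment k s \<le> majorant k s"
    and "majorant k s \<le> (majorant_const k + q * majorant_poly k 1 * (real k / (real k * drift - p))) * scaled_moment k s"
proof -
  let ?N = "num_balls s" and ?e = "real k / (real k * drift - p)"
  note w = weight_pos[OF one_le_k, of ?N]
  have N: "1 \<le> ?N" using num_balls_pos[OF s] by simp
  note t = weight_tail_bounds[OF one_le_k k(2) N]
  have C: "0 \<le> q * majorant_poly k 1" using q_bounds majorant_poly_1_nonneg by simp
  have "0 \<le> ?e" using k by simp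
  note F = colour_sum_rising_poly_bounds[OF base_nonneg one_le_k, of s, folded majorant_poly_def majorant_const_def]
  show "scaled_moment k s \<le> majorant k s"
    unfolding scaled_moment_def majorant_def using F(2) w t C
    by (intro order_trans[OF mult_left_mono[OF F(2)]]) auto
  have "?N * weight k ?N \<le> weight k ?N * rising_moment k s"
    using num_balls_le_rising_moment[OF s one_le_k] w by (simp add: mult.commute)
  then have "weight_tail k ?N \<le> ?e * (weight k ?N * rising_moment k s)"
    using t(2) \<open>0 \<le> ?e\<close> by (meson mult_left_mono order_trans)
  then have "q * majorant_poly k 1 * weight_tail k ?N \<le> q * majorant_poly k 1 * (?e * (weight k ?N * rising_moment k s))"
    using C by (intro mult_left_mono)
  moreover have "weight k ?N * colour_sum (majorant_poly k) s \<le> weight k ?N * (majorant_const k * rising_moment k s)"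
    using F(1) w by (intro mult_left_mono) auto
  ultimately show "majorant k s \<le> (majorant_const k + q * majorant_poly k 1 * ?e) * scaled_moment k s"
    unfolding majorant_def scaled_moment_def by (simp add: algebra_simps)
qed

text \<open>A move changes the colour counts, the weight in front of the whole sum, and the tail;
  \<open>?D\<close>, \<open>b\<close> and \<open>c\<close> measure the three effects. Averaged over
  the drawn colour, each square is at most a multiple of the moment of order 2 k - 1 over N: by
  \<open>square_pochhammer_le\<close>, by \<open>rising_moment_square_le\<close>, and because that
  moment is at least N.\<close>

lemma majorant_square_increment:
  assumes s: "admissible s"
  shows "step_exp p (\<lambda>t. (majorant k t - majorant k s) ^ 2) s \<le>
    increment_const k * weight k (num_balls s) ^ 2 * rising_moment (2 * k - 1) s / num_balls s"
proof -
  let ?f = "majorant_poly k" and ?N = "num_balls s" and ?K = "majorant_const k"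
  let ?F = "colour_sum ?f s" and ?D = "\<lambda>x. pochhammer (real (Suc x)) (k - 1)"
  define g g' where "g = weight k ?N" and "g' = weight k (Suc ?N)"
  define C where "C = q * ?f 1"
  define b c where "b = real k * ?F / ?N" and "c = C / p"
  have N: "1 \<le> ?N" "1 \<le> real ?N" using num_balls_pos[OF s] by auto
  have g: "0 < g" "0 < g'" "g' \<le> g" "g - g' \<le> g * (real k / real ?N)"
    unfolding g_def g'_def using weight_pos[OF one_le_k] weight_diff[OF one_le_k N(1)] by auto
  have t: "weight_tail k ?N - weight_tail k (Suc ?N) = g / p"
    unfolding g_def by (rule weight_tail_diff[OF one_le_k k(2)])
  have C: "0 \<le> C" unfolding C_def using q_bounds majorant_poly_1_nonneg by simp
  have F: "0 \<le> ?F" "?F \<le> ?K * rising_moment k s"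
    using colour_sum_rising_poly_bounds[OF base_nonneg one_le_k, of s, folded majorant_poly_def majorant_const_def]
      rising_moment_nonneg[of k s] by auto
  have bc: "0 \<le> b" "0 \<le> c" unfolding b_def c_def using F C p_bounds by auto
  note diff = rising_poly_diff[OF base_nonneg, of _ _ k, folded majorant_poly_def majorant_const_def]
  have f0: "?f 0 = 0" unfolding majorant_poly_def by (rule rising_poly_0)
  have K: "0 \<le> ?K" unfolding majorant_const_def using base_nonneg by (rule rising_const_nonneg)
  let ?up = "\<lambda>x. g' * (?F + (?f (Suc x) - ?f x)) + C * weight_tail k (Suc ?N) - (g * ?F + C * weight_tail k ?N)"
  let ?down = "\<lambda>x. g * (?F + (?f (x - 1) - ?f x) + ?f 1) + C * weight_tail k ?N - (g * ?F + C * weight_tail k ?N)"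
  have eq: "step_exp p (\<lambda>t. (majorant k t - majorant k s) ^ 2) s =
      colour_sum (\<lambda>x. real x * (p * ?up x ^ 2 + (1 - p) * ?down x ^ 2)) s / real ?N"
    unfolding majorant_def C_def[symmetric] g_def g'_def using s p_bounds
    by (intro step_exp_eq')
      (simp_all add: num_balls_copy num_balls_recolour colour_sum_copy colour_sum_recolour)
  have pt: "p * ?up x ^ 2 + (1 - p) * ?down x ^ 2 \<le> (g * (?K * ?D x + b + c)) ^ 2" if x: "1 \<le> x" for x
  proof -
    have D: "0 \<le> ?K * ?D x" using K by (intro mult_nonneg_nonneg pochhammer_nonneg) auto
    have up_eq: "?up x = g' * (?f (Suc x) - ?f x) - (g - g') * ?F - g * c"
    proof -
      have "C * weight_tail k (Suc ?N) = C * weight_tail k ?N - g * c" using t by (simp add: c_def algebra_simps)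
      then show ?thesis by (simp add: algebra_simps)
    qed
    have 1: "0 \<le> g' * (?f (Suc x) - ?f x)" "g' * (?f (Suc x) - ?f x) \<le> g * (?K * ?D x)"
      using diff[of x x] g K by (auto intro!: mult_nonneg_nonneg mult_mono)
    have 2: "0 \<le> (g - g') * ?F" "(g - g') * ?F \<le> g * b"
      using g F mult_right_mono[OF g(4) F(1)] by (auto simp: b_def)
    have 3: "0 \<le> g * c" using g bc by auto
    have up: "\<bar>?up x\<bar> \<le> g * (?K * ?D x + b + c)"
    proof -
      have "g * (?K * ?D x + b + c) = g * (?K * ?D x) + g * b + g * c" by (simp add: distrib_left)
      then show ?thesis using 1 2 3 up_eq by linarith
    qed
    have "?f x - ?f (x - 1) \<le> ?K * ?D x" "0 \<le> ?f x - ?f (x - 1)"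
      using diff[of "x - 1" x] x by auto
    moreover have "?f 1 \<le> ?K * ?D x" "0 \<le> ?f 1"
      using diff[of 0 x] f0 by auto
    \<comment> \<open>The loss of a ball and the birth have opposite signs and obey the same bound,
      so their sum obeys it too.\<close>
    ultimately have "\<bar>(?f (x - 1) - ?f x) + ?f 1\<bar> \<le> ?K * ?D x + b + c"
      using bc by linarith
    then have "\<bar>g * ((?f (x - 1) - ?f x) + ?f 1)\<bar> \<le> g * (?K * ?D x + b + c)"
      unfolding abs_mult using g by (intro mult_mono) auto
    then have down: "\<bar>?down x\<bar> \<le> g * (?K * ?D x + b + c)"
      by (simp add: algebra_simps)
    have "?up x ^ 2 \<le> (g * (?K * ?D x + b + c)) ^ 2" "?down x ^ 2 \<le> (g * (?K * ?D x + b + c)) ^ 2"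
      using up down by (metis abs_ge_zero power2_abs power_mono)+
    then have "p * ?up x ^ 2 + (1 - p) * ?down x ^ 2 \<le>
        p * (g * (?K * ?D x + b + c)) ^ 2 + (1 - p) * (g * (?K * ?D x + b + c)) ^ 2"
      using p_bounds by (intro add_mono mult_left_mono) auto
    then show ?thesis by (simp add: algebra_simps)
  qed
  have pt2: "real x * (p * ?up x ^ 2 + (1 - p) * ?down x ^ 2) \<le>
      3 * g ^ 2 * (?K ^ 2 * pochhammer (real x) (2 * k - 1) + (b ^ 2 + c ^ 2) * real x)" for x
  proof (cases "x = 0")
    case True
    then show ?thesis using k by (simp add: pochhammer_0_left)
  next
    case False
    have "real x * (p * ?up x ^ 2 + (1 - p) * ?down x ^ 2) \<le> real x * (g * (?K * ?D x + b + c)) ^ 2"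
      using False pt[of x] by (intro mult_left_mono) auto
    also have "\<dots> \<le> real x * (g ^ 2 * (3 * ((?K * ?D x) ^ 2 + b ^ 2 + c ^ 2)))"
      unfolding power_mult_distrib[of g] by (intro mult_left_mono sum3_square_le) auto
    also have "\<dots> = 3 * g ^ 2 * (?K ^ 2 * (real x * ?D x ^ 2) + (b ^ 2 + c ^ 2) * real x)"
      by (simp add: power_mult_distrib algebra_simps)
    also have "\<dots> \<le> 3 * g ^ 2 * (?K ^ 2 * pochhammer (real x) (2 * k - 1) + (b ^ 2 + c ^ 2) * real x)"
      by (intro mult_left_mono add_right_mono square_pochhammer_le one_le_k) auto
    finally show ?thesis .
  qed
  let ?R = "rising_moment (2 * k - 1) s / real ?N"
  have "step_exp p (\<lambda>t. (majorant k t - majorant k s) ^ 2) s \<le>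
      colour_sum (\<lambda>x. 3 * g ^ 2 * (?K ^ 2 * pochhammer (real x) (2 * k - 1) + (b ^ 2 + c ^ 2) * real x)) s / real ?N"
    unfolding eq using N by (intro divide_right_mono colour_sum_mono pt2) auto
  also have "\<dots> = 3 * g ^ 2 * (?K ^ 2 * rising_moment (2 * k - 1) s + (b ^ 2 + c ^ 2) * real ?N) / real ?N"
    unfolding num_balls_eq_colour_sum[OF s] rising_moment_def colour_sum_def
    by (simp add: sum_distrib_left sum.distrib distrib_left)
  also have "\<dots> = 3 * g ^ 2 * (?K ^ 2 * ?R + (b ^ 2 + c ^ 2))"
    using N by (simp add: field_simps)
  also have "\<dots> \<le> 3 * g ^ 2 * (?K ^ 2 * ?R + ((real k * ?K) ^ 2 * ?R + c ^ 2 * ?R))"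
  proof (intro mult_left_mono add_left_mono add_mono)
    have "b ^ 2 \<le> (real k * (?K * rising_moment k s) / ?N) ^ 2"
      unfolding b_def using F N by (intro power_mono divide_right_mono mult_left_mono) auto
    also have "\<dots> = (real k * ?K) ^ 2 * (rising_moment k s ^ 2 / ?N ^ 2)"
      by (simp add: power_mult_distrib power_divide)
    also have "\<dots> \<le> (real k * ?K) ^ 2 * (real ?N * rising_moment (2 * k - 1) s / ?N ^ 2)"
      by (intro mult_left_mono divide_right_mono rising_moment_square_le s one_le_k) auto
    also have "\<dots> = (real k * ?K) ^ 2 * ?R" using N by (simp add: power2_eq_square)
    finally show "b ^ 2 \<le> (real k * ?K) ^ 2 * ?R" .
    have "1 \<le> ?R" using num_balls_le_rising_moment[OF s, of "2 * k - 1"] k N by simp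
    then show "c ^ 2 \<le> c ^ 2 * ?R" using mult_left_mono[of 1 ?R "c ^ 2"] by simp
  qed auto
  also have "\<dots> = increment_const k * g ^ 2 * ?R"
    by (simp add: increment_const_def c_def C_def algebra_simps)
  finally show ?thesis by (simp add: g_def)
qed

lemma increment_const_nonneg: "0 \<le> increment_const k"
  by (simp add: increment_const_def)

lemma second_base_nonneg: "0 \<le> lyapunov_base (2 * k) (increment_const k)"
  using lyapunov_base_ge_1[OF _ increment_const_nonneg, of "2 * k"] k by simp

lemma square_poly_1_nonneg: "0 \<le> square_poly k 1"
  using rising_poly_ge[OF second_base_nonneg, of "2 * k" 1] k pochhammer_real_nonneg[of 1 "2 * k"]
  unfolding square_poly_def by auto

lemma square_majorant_supermartingale:
  assumes s: "admissible s"
  shows "step_exp p (square_majorant k) s \<le> square_majorant k s"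
proof -
  let ?N = "num_balls s" and ?h = "square_poly k" and ?Y = "majorant k"
  let ?g = "weight k ?N" and ?t = "weight_tail k ?N" and ?g' = "weight k (Suc ?N)" and ?t' = "weight_tail k (Suc ?N)"
  let ?W = "\<lambda>s. weight k (num_balls s) ^ 2 * colour_sum ?h s"
  let ?T = "\<lambda>s. weight k (num_balls s) * weight_tail k (num_balls s)"
  have N: "1 \<le> ?N" using num_balls_pos[OF s] by auto
  have const: "step_exp p (\<lambda>_. a) s = a" for a by (simp add: step_exp_def)
  have C: "0 \<le> q * ?h 1" using q_bounds square_poly_1_nonneg by simp
  have Y0: "0 \<le> ?Y s" using majorant_bounds(1)[OF s] scaled_moment_pos[OF s one_le_k] by simp
  \<comment> \<open>Expanding around the current value isolates the quadratic variation; the linear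
    term has the coefficient 2 \<open>?Y s\<close> >= 0, so the supermartingale property bounds
    it.\<close>
  have "(\<lambda>t. ?Y t ^ 2) = (\<lambda>t. (?Y t - ?Y s) ^ 2 + (2 * ?Y s * ?Y t + (- (?Y s ^ 2))))"
    by (auto simp: power2_eq_square algebra_simps)
  then have "step_exp p (\<lambda>t. ?Y t ^ 2) s =
      step_exp p (\<lambda>t. (?Y t - ?Y s) ^ 2) s + (2 * ?Y s * step_exp p ?Y s + (- (?Y s ^ 2)))"
    by (simp only: step_exp_add[OF s] step_exp_cmult const)
  also have "\<dots> \<le> increment_const k * ?g ^ 2 * rising_moment (2 * k - 1) s / ?N + (2 * ?Y s * ?Y s + (- (?Y s ^ 2)))"
    using Y0 by (intro add_mono mult_left_mono majorant_square_increment majorant_supermartingale s) auto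
  finally have 1: "step_exp p (\<lambda>t. ?Y t ^ 2) s \<le>
      ?Y s ^ 2 + increment_const k * ?g ^ 2 * rising_moment (2 * k - 1) s / ?N"
    by (simp add: power2_eq_square)
  have 2: "step_exp p ?W s \<le>
     ?g ^ 2 * (colour_sum ?h s + q * ?h 1 - increment_const k * rising_moment (2 * k - 1) s / ?N)"
    unfolding square_poly_def using k increment_const_nonneg weight_square_rec[OF one_le_k]
    by (intro step_exp_rising_poly_le s) auto
  \<comment> \<open>The squared weight needs its own fund for births. The product of weight and tail
    loses at least \<open>?g ^ 2 / p\<close> when N grows, because the weight decreases.\<close>
  have "?g' * ?t' \<le> ?g * ?t'"
    using weight_diff(1)[OF one_le_k N] weight_tail_bounds(1)[OF one_le_k k(2), of "Suc ?N"] by (intro mult_right_mono) auto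
  also have "\<dots> = ?g * ?t - ?g ^ 2 / p"
  proof -
    have "?t' = ?t - ?g / p" using weight_tail_diff[OF one_le_k k(2), of ?N] by simp
    then show ?thesis by (simp only: right_diff_distrib) (simp add: power2_eq_square)
  qed
  finally have "p * (?g' * ?t') \<le> p * (?g * ?t - ?g ^ 2 / p)"
    using p_bounds by (intro mult_left_mono) auto
  then have "step_exp p ?T s \<le> ?g * ?t - ?g ^ 2"
    using p_bounds step_exp_num_balls[OF s p_bounds(1,2), of "\<lambda>n. weight k n * weight_tail k n"]
    by (simp add: algebra_simps)
  then have 3: "q * ?h 1 * step_exp p ?T s \<le> q * ?h 1 * (?g * ?t - ?g ^ 2)"
    using C by (rule mult_left_mono)
  have "step_exp p (square_majorant k) s =
      step_exp p (\<lambda>t. ?Y t ^ 2) s + (step_exp p ?W s + q * ?h 1 * step_exp p ?T s)"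
    unfolding square_majorant_def by (simp only: step_exp_add[OF s] step_exp_cmult)
  also have "\<dots> \<le> (?Y s ^ 2 + increment_const k * ?g ^ 2 * rising_moment (2 * k - 1) s / ?N) +
     (?g ^ 2 * (colour_sum ?h s + q * ?h 1 - increment_const k * rising_moment (2 * k - 1) s / ?N) +
      q * ?h 1 * (?g * ?t - ?g ^ 2))"
    by (intro add_mono 1 2 3)
  also have "\<dots> = square_majorant k s"
    by (simp add: square_majorant_def algebra_simps)
  finally show ?thesis .
qed

lemma square_majorant_bounds:
  obtains C where "1 \<le> C"
    "\<And>s. admissible s \<Longrightarrow> scaled_moment k s ^ 2 \<le> square_majorant k s"
    "\<And>s. admissible s \<Longrightarrow> square_majorant k s \<le> C * scaled_moment k s ^ 2"
proof -
  let ?e = "real k / (real k * drift - p)" and ?h = "square_poly k"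
  let ?c1 = "majorant_const k + q * majorant_poly k 1 * ?e"
  let ?c2 = "rising_const (lyapunov_base (2 * k) (increment_const k)) (2 * k) * (real k + 1) ^ k"
  let ?c3 = "q * ?h 1 * ?e"
  have e0: "0 \<le> ?e" using k by simp
  have h0: "0 \<le> q * ?h 1" using q_bounds square_poly_1_nonneg by simp
  have c2: "0 \<le> rising_const (lyapunov_base (2 * k) (increment_const k)) (2 * k)"
    by (rule rising_const_nonneg[OF second_base_nonneg])
  have main: "scaled_moment k s ^ 2 \<le> square_majorant k s \<and> square_majorant k s \<le> (?c1 ^ 2 + (?c2 + ?c3)) * scaled_moment k s ^ 2"
    if s: "admissible s" for s
  proof -
    let ?N = "num_balls s"
    let ?g = "weight k ?N" and ?t = "weight_tail k ?N" and ?V = "scaled_moment k s"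
    note g = weight_pos[OF one_le_k, of ?N]
    have N: "1 \<le> ?N" using num_balls_pos[OF s] by simp
    have V0: "0 < ?V" by (rule scaled_moment_pos[OF s one_le_k])
    note t = weight_tail_bounds[OF one_le_k k(2) N]
    note H = colour_sum_rising_poly_bounds[OF second_base_nonneg, of "2 * k" s, folded square_poly_def]
    have H0: "0 \<le> colour_sum ?h s" using H(2) rising_moment_nonneg[of "2 * k" s] k by simp
    have Y: "?V \<le> majorant k s" "majorant k s \<le> ?c1 * ?V" by (rule majorant_bounds[OF s])+
    have Y2: "?V ^ 2 \<le> majorant k s ^ 2" using Y V0 by (intro power_mono) auto
    have "majorant k s ^ 2 \<le> (?c1 * ?V) ^ 2" using Y V0 by (intro power_mono) auto
    then have 1: "majorant k s ^ 2 \<le> ?c1 ^ 2 * ?V ^ 2" by (simp only: power_mult_distrib)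
    have "colour_sum ?h s \<le> rising_const (lyapunov_base (2 * k) (increment_const k)) (2 * k) * rising_moment (2 * k) s"
      using H(1) k by simp
    also have "\<dots> \<le> rising_const (lyapunov_base (2 * k) (increment_const k)) (2 * k) *
        ((real k + 1) ^ k * rising_moment k s ^ 2)"
      by (intro mult_left_mono rising_moment_double_le one_le_k c2)
    finally have "?g ^ 2 * colour_sum ?h s \<le> ?g ^ 2 * (?c2 * rising_moment k s ^ 2)"
      by (intro mult_left_mono) (auto simp: mult.assoc)
    then have 2: "?g ^ 2 * colour_sum ?h s \<le> ?c2 * ?V ^ 2"
      by (simp add: scaled_moment_def power_mult_distrib mult_ac)
    have S: "real ?N \<le> rising_moment k s" "1 \<le> rising_moment k s"
      using num_balls_le_rising_moment[OF s one_le_k] N by auto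
    have "?g * ?t \<le> ?g * (?e * (real ?N * ?g))" using t(2) g by (intro mult_left_mono) auto
    also have "\<dots> = ?e * (?g ^ 2 * real ?N)" by (simp add: power2_eq_square)
    \<comment> \<open>The moment is at least N and at least 1, hence N is also at most its
      square.\<close>
    also have "\<dots> \<le> ?e * (?g ^ 2 * rising_moment k s ^ 2)"
      using S by (intro mult_left_mono e0) (auto simp: power2_eq_square intro: order_trans[of _ "rising_moment k s"])
    finally have "?g * ?t \<le> ?e * ?V ^ 2" by (simp add: scaled_moment_def power_mult_distrib)
    then have 3: "q * ?h 1 * (?g * ?t) \<le> ?c3 * ?V ^ 2"
      using h0 by (metis mult.assoc mult_left_mono)
    have "0 \<le> q * ?h 1 * (?g * ?t)" using h0 t(1) g by simp
    moreover have "0 \<le> ?g ^ 2 * colour_sum ?h s" using H0 by simp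
    ultimately have "?V ^ 2 \<le> square_majorant k s" unfolding square_majorant_def using Y2 by linarith
    moreover have "square_majorant k s \<le> (?c1 ^ 2 + (?c2 + ?c3)) * ?V ^ 2"
      unfolding square_majorant_def distrib_right by (intro add_mono 1 2 3)
    ultimately show ?thesis by blast
  qed
  show ?thesis
  \<comment> \<open>The maximum with 1 keeps 1 - 1/C nonnegative in the extinction estimate.\<close>
  proof (rule that[of "max 1 (?c1 ^ 2 + (?c2 + ?c3))"])
    fix s assume s: "admissible s"
    show "scaled_moment k s ^ 2 \<le> square_majorant k s" using main[OF s] by blast
    have "(?c1 ^ 2 + (?c2 + ?c3)) * scaled_moment k s ^ 2 \<le> max 1 (?c1 ^ 2 + (?c2 + ?c3)) * scaled_moment k s ^ 2"
      by (intro mult_right_mono) auto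
    with main[OF s] show "square_majorant k s \<le> max 1 (?c1 ^ 2 + (?c2 + ?c3)) * scaled_moment k s ^ 2" by linarith
  qed simp
qed

end

end

section \<open>Almost sure convergence of submartingales\<close>

text \<open>Doob's buy-low, sell-high strategy: a position is opened at a value <= a and closed at a
  value >= b. The state at n depends on y 0, ..., y n only and is applied to the increment from n to
  n + 1.\<close>

primrec holding :: "real \<Rightarrow> real \<Rightarrow> (nat \<Rightarrow> real) \<Rightarrow> nat \<Rightarrow> bool" where
  "holding a b y 0 \<longleftrightarrow> y 0 \<le> a"
| "holding a b y (Suc n) \<longleftrightarrow> (if holding a b y n then y (Suc n) < b else y (Suc n) \<le> a)"

primrec upcrossings :: "real \<Rightarrow> real \<Rightarrow> (nat \<Rightarrow> real) \<Rightarrow> nat \<Rightarrow> nat" where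
  "upcrossings a b y 0 = 0"
| "upcrossings a b y (Suc n) =
     upcrossings a b y n + (if holding a b y n \<and> b \<le> y (Suc n) then 1 else 0)"

lemma upcrossings_mono: "m \<le> n \<Longrightarrow> upcrossings a b y m \<le> upcrossings a b y n"
  by (rule lift_Suc_mono_le[of "upcrossings a b y"]) auto

text \<open>Cutting y off below at a ensures that an open position is never under water. The second
  summand is the unrealised gain of such a position, which the induction must carry along.\<close>

lemma upcrossings_gain:
  assumes "a < b"
  shows "(b - a) * real (upcrossings a b y n) + (if holding a b y n then max (y n) a - a else 0) \<le>
    (\<Sum>i<n. of_bool (holding a b y i) * (max (y (Suc i)) a - max (y i) a))"
proof (induction n)
  case (Suc n)
  then show ?case using assms by (auto simp: algebra_simps max_def split: if_splits)
qed (auto simp: max_def)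

lemma holdingI: "a < b \<Longrightarrow> y n \<le> a \<Longrightarrow> holding a b y n"
  by (cases n) auto

lemma upcrossing_occurs:
  assumes "a < b" "y m \<le> a" "m \<le> n" "b \<le> y n"
  shows "upcrossings a b y m < upcrossings a b y n"
proof -
  have "holding a b y i \<or> upcrossings a b y m < upcrossings a b y i" if "m \<le> i" for i
    using that
  proof (induction i rule: dec_induct)
    case base
    then show ?case using holdingI assms by blast
  next
    case (step i)
    then show ?case using upcrossings_mono[OF step(1), of a b y] by auto
  qed
  moreover have "m < n" using assms by (metis le_neq_implies_less not_le order.strict_trans2)
  then obtain i where i: "n = Suc i" "m \<le> i" by (metis Suc_le_D Suc_le_mono less_eq_Suc_le)
  ultimately show ?thesis using assms(4) upcrossings_mono[OF i(2), of a b y] by fastforce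
qed

text \<open>Upcrossings exclude oscillation but not escape to infinity; \<open>bound\<close>
  excludes the latter. Rational levels suffice and keep the exceptional set a countable
  union.\<close>

lemma convergent_if_finitely_many_upcrossings:
  assumes nonneg: "\<And>n. 0 \<le> y n"
    and up: "\<And>a b. a \<in> \<rat> \<Longrightarrow> b \<in> \<rat> \<Longrightarrow> a < b \<Longrightarrow> bdd_above (range (upcrossings a b y))"
    and bound: "\<exists>\<^sub>F n in sequentially. y n \<le> K"
  shows "convergent y"
proof -
  let ?x = "\<lambda>n. ereal (y n)"
  have "limsup ?x \<le> liminf ?x"
  proof (rule ccontr)
    assume "\<not> limsup ?x \<le> liminf ?x"
    then have "liminf ?x < limsup ?x" by simp
    then obtain u where u: "liminf ?x < ereal u" "ereal u < limsup ?x" using ereal_dense2 by blast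
    then obtain v where v: "ereal u < ereal v" "ereal v < limsup ?x" using ereal_dense2 by blast
    obtain a where a: "a \<in> \<rat>" "u < a" "a < (u + v) / 2"
      using Rats_dense_in_real[of u "(u + v) / 2"] v by auto
    obtain b where b: "b \<in> \<rat>" "(u + v) / 2 < b" "b < v"
      using Rats_dense_in_real[of "(u + v) / 2" v] v by auto
    have "liminf ?x < ereal a" using u a by (meson ereal_less(2) less_ereal.simps(1) order.strict_trans)
    then have low: "\<exists>\<^sub>F n in sequentially. y n < a"
      using Liminf_bounded[of "ereal a" ?x sequentially] by (auto simp: frequently_def not_less)
    have "ereal b < limsup ?x" using v b by (meson less_ereal.simps(1) order.strict_trans)
    then have high: "\<exists>\<^sub>F n in sequentially. b < y n"
      using Limsup_bounded[of ?x "ereal b" sequentially] by (auto simp: frequently_def not_less)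
    have ab: "a < b" using a b by simp
    have "\<exists>n. m \<le> upcrossings a b y n" for m
    proof (induction m)
      case (Suc m)
      then obtain n where n: "m \<le> upcrossings a b y n" by blast
      obtain n1 where n1: "n \<le> n1" "y n1 < a" using low by (auto simp: frequently_sequentially)
      obtain n2 where n2: "n1 \<le> n2" "b < y n2" using high by (auto simp: frequently_sequentially)
      have "upcrossings a b y n1 < upcrossings a b y n2"
        using ab n1 n2 by (intro upcrossing_occurs) auto
      with n upcrossings_mono[OF n1(1), of a b y] have "Suc m \<le> upcrossings a b y n2" by linarith
      then show ?case by blast
    qed auto
    moreover obtain B where "\<And>n. upcrossings a b y n \<le> B"
      using up[OF a(1) b(1) ab] by (auto simp: bdd_above_def)
    ultimately show False by (meson Suc_n_not_le_n le_trans)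
  qed
  then have eq: "liminf ?x = limsup ?x"
    by (intro antisym Liminf_le_Limsup) simp_all
  then have lim: "?x \<longlonglongrightarrow> limsup ?x"
    by (intro Liminf_eq_Limsup) simp_all
  have "0 \<le> limsup ?x" using le_Limsup[of sequentially 0 ?x] nonneg by (simp add: zero_ereal_def)
  moreover have "limsup ?x \<le> ereal K"
  proof (rule ccontr)
    assume "\<not> limsup ?x \<le> ereal K"
    then have "\<forall>\<^sub>F n in sequentially. ereal K < ?x n"
      using order_tendstoD(1)[OF lim, of "ereal K"] by (simp add: not_le)
    with bound show False by (simp add: frequently_def not_le)
  qed
  ultimately obtain L where "limsup ?x = ereal L" by (cases "limsup ?x") auto
  with lim show ?thesis by (auto simp: convergent_def)
qed

lemma (in prob_space) AE_bdd_above_if_expectation_bounded: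
  fixes f :: "nat \<Rightarrow> 'a \<Rightarrow> nat"
  assumes f [measurable]: "\<And>n. (\<lambda>\<omega>. real (f n \<omega>)) \<in> borel_measurable M"
    and mono: "\<And>m n \<omega>. m \<le> n \<Longrightarrow> f m \<omega> \<le> f n \<omega>"
    and int: "\<And>n. integrable M (\<lambda>\<omega>. real (f n \<omega>))"
    and bound: "\<And>n. expectation (\<lambda>\<omega>. real (f n \<omega>)) \<le> K"
  shows "AE \<omega> in M. bdd_above (range (\<lambda>n. f n \<omega>))"
proof -
  let ?g = "\<lambda>n \<omega>. ennreal (real (f n \<omega>))"
  have "(\<integral>\<^sup>+\<omega>. (SUP n. ?g n \<omega>) \<partial>M) = (SUP n. \<integral>\<^sup>+\<omega>. ?g n \<omega> \<partial>M)"
    by (rule nn_integral_monotone_convergence_SUP)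
      (auto simp: incseq_def le_fun_def intro!: ennreal_leI mono)
  also have "\<dots> \<le> ennreal K"
  proof (rule SUP_least)
    fix n show "(\<integral>\<^sup>+\<omega>. ?g n \<omega> \<partial>M) \<le> ennreal K"
      using bound[of n] by (subst nn_integral_eq_integral[OF int]) (auto intro: ennreal_leI)
  qed
  finally have "(\<integral>\<^sup>+\<omega>. (SUP n. ?g n \<omega>) \<partial>M) \<noteq> \<infinity>" by (auto simp: top_unique)
  then have "AE \<omega> in M. (SUP n. ?g n \<omega>) \<noteq> \<infinity>"
    by (intro nn_integral_PInf_AE) auto
  then show ?thesis
  proof eventually_elim
    case (elim \<omega>)
    then obtain r where r: "(SUP n. ?g n \<omega>) = ennreal r" "0 \<le> r" by (cases "SUP n. ?g n \<omega>") auto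
    have "f n \<omega> \<le> nat \<lceil>r\<rceil>" for n
    proof -
      have "?g n \<omega> \<le> ennreal r" unfolding r(1)[symmetric] by (rule SUP_upper) simp
      then have "real (f n \<omega>) \<le> r" using r(2) by simp
      then show ?thesis by linarith
    qed
    then show ?case by (auto simp: bdd_above_def)
  qed
qed

section \<open>The convergence theorem for nonnegative submartingales of the chain\<close>

context infinite_colour_urn
begin

lemma step_exp_mono:
  assumes "admissible s" "\<And>t. admissible t \<Longrightarrow> \<phi> t \<le> \<psi> t"
  shows "step_exp p \<phi> s \<le> step_exp p \<psi> s"
  unfolding step_exp_def
proof (intro integral_mono_AE integrable_measure_pmf_finite finite_set_pmf_urn_step assms(1))
  show "AE t in measure_pmf (urn_step p s). \<phi> t \<le> \<psi> t"
    using admissible_urn_step[OF assms(1)] assms(2) by (simp add: AE_measure_pmf_iff)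
qed

lemma adapted_holding: "adapted n (\<lambda>\<omega>. of_bool (holding a b (\<lambda>i. \<phi> (X i \<omega>)) n))"
  unfolding adapted_def
proof (intro allI impI)
  fix \<omega> \<omega>' assume "\<forall>i\<le>n. X i \<omega> = X i \<omega>'"
  then have "holding a b (\<lambda>i. \<phi> (X i \<omega>)) n = holding a b (\<lambda>i. \<phi> (X i \<omega>')) n"
    by (induction n) auto
  then show "of_bool (holding a b (\<lambda>i. \<phi> (X i \<omega>)) n) = (of_bool (holding a b (\<lambda>i. \<phi> (X i \<omega>')) n) :: real)"
    by simp
qed

lemma adapted_upcrossings: "adapted n (\<lambda>\<omega>. real (upcrossings a b (\<lambda>i. \<phi> (X i \<omega>)) n))"
  unfolding adapted_def
proof (intro allI impI)
  fix \<omega> \<omega>' assume "\<forall>i\<le>n. X i \<omega> = X i \<omega>'"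
  then have "upcrossings a b (\<lambda>i. \<phi> (X i \<omega>)) n = upcrossings a b (\<lambda>i. \<phi> (X i \<omega>')) n
    \<and> holding a b (\<lambda>i. \<phi> (X i \<omega>)) n = holding a b (\<lambda>i. \<phi> (X i \<omega>')) n"
    by (induction n) auto
  then show "real (upcrossings a b (\<lambda>i. \<phi> (X i \<omega>)) n) = real (upcrossings a b (\<lambda>i. \<phi> (X i \<omega>')) n)"
    by simp
qed

lemma integrable_state: "integrable M (\<lambda>\<omega>. \<phi> (X n \<omega>) :: real)"
  by (rule adapted_integrable[OF adapted_state[OF order_refl]])

lemma measurable_state [measurable]: "(\<lambda>\<omega>. \<phi> (X n \<omega>) :: real) \<in> borel_measurable M"
  using integrable_state by (rule borel_measurable_integrable)

text \<open>The gain of the strategy on the truncated submartingale dominates (b - a) times the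
  upcrossings, and is in mean at most the gain from holding throughout, which is bounded.\<close>

lemma submartingale_upcrossings:
  assumes sub: "\<And>s. admissible s \<Longrightarrow> \<phi> s \<le> step_exp p \<phi> s"
    and nonneg: "\<And>s. admissible s \<Longrightarrow> 0 \<le> \<phi> s"
    and bound: "\<And>n. expectation (\<lambda>\<omega>. \<phi> (X n \<omega>)) \<le> K"
    and ab: "a < b"
  shows "AE \<omega> in M. bdd_above (range (upcrossings a b (\<lambda>n. \<phi> (X n \<omega>))))"
proof (rule AE_bdd_above_if_expectation_bounded)
  let ?y = "\<lambda>\<omega> n. \<phi> (X n \<omega>)" and ?z = "\<lambda>s. max (\<phi> s) a"
  let ?H = "\<lambda>i \<omega>. of_bool (holding a b (?y \<omega>) i) :: real"
  have sub_z: "?z s \<le> step_exp p ?z s" if s: "admissible s" for s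
  proof -
    have "\<phi> s \<le> step_exp p ?z s"
      using sub[OF s] by (rule order_trans) (auto intro: step_exp_mono[OF s])
    moreover have "step_exp p (\<lambda>_. a) s \<le> step_exp p ?z s"
      by (auto intro: step_exp_mono[OF s])
    ultimately show ?thesis by (simp add: step_exp_def)
  qed
  fix n
  show int: "integrable M (\<lambda>\<omega>. real (upcrossings a b (?y \<omega>) n))" for n
    by (rule adapted_integrable[OF adapted_upcrossings])
  then show "(\<lambda>\<omega>. real (upcrossings a b (?y \<omega>) n)) \<in> borel_measurable M"
    by (rule borel_measurable_integrable)
  have intH: "integrable M (\<lambda>\<omega>. ?H i \<omega> * ?z (X j \<omega>))" if "i \<le> j" for i j
    by (rule adapted_integrable[of j])
      (intro adapted_mult adapted_mono[OF adapted_holding] adapted_state that order_refl)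
  have "(b - a) * expectation (\<lambda>\<omega>. real (upcrossings a b (?y \<omega>) n)) =
      expectation (\<lambda>\<omega>. (b - a) * real (upcrossings a b (?y \<omega>) n))"
    by simp
  also have "\<dots> \<le> expectation (\<lambda>\<omega>. \<Sum>i<n. ?H i \<omega> * ?z (X (Suc i) \<omega>) - ?H i \<omega> * ?z (X i \<omega>))"
  proof (intro integral_mono)
    show "integrable M (\<lambda>\<omega>. (b - a) * real (upcrossings a b (?y \<omega>) n))" using int by simp
    show "integrable M (\<lambda>\<omega>. \<Sum>i<n. ?H i \<omega> * ?z (X (Suc i) \<omega>) - ?H i \<omega> * ?z (X i \<omega>))"
      by (intro Bochner_Integration.integrable_sum Bochner_Integration.integrable_diff intH) auto
    fix \<omega>
    have "0 \<le> (if holding a b (?y \<omega>) n then ?z (X n \<omega>) - a else 0)" by auto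
    then show "(b - a) * real (upcrossings a b (?y \<omega>) n) \<le>
        (\<Sum>i<n. ?H i \<omega> * ?z (X (Suc i) \<omega>) - ?H i \<omega> * ?z (X i \<omega>))"
      using upcrossings_gain[OF ab, of "?y \<omega>" n] by (simp only: right_diff_distrib)
  qed
  also have "\<dots> = (\<Sum>i<n. expectation (\<lambda>\<omega>. ?H i \<omega> * ?z (X (Suc i) \<omega>)) - expectation (\<lambda>\<omega>. ?H i \<omega> * ?z (X i \<omega>)))"
    by (subst Bochner_Integration.integral_sum)
      (auto intro!: Bochner_Integration.integrable_diff intH sum.cong Bochner_Integration.integral_diff)
  also have "\<dots> \<le> (\<Sum>i<n. expectation (\<lambda>\<omega>. ?z (X (Suc i) \<omega>)) - expectation (\<lambda>\<omega>. ?z (X i \<omega>)))"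
  proof (rule sum_mono)
    fix i
    \<comment> \<open>The complementary strategy also has nonnegative mean gain, so replacing
      \<open>?H i\<close> by 1 only increases the right side.\<close>
    have "adapted i (\<lambda>\<omega>. 1 - ?H i \<omega>)"
      by (rule adapted_comp2[where f = "(-)"]) (rule adapted_const adapted_holding)+
    then have "expectation (\<lambda>\<omega>. (1 - ?H i \<omega>) * ?z (X i \<omega>)) \<le> expectation (\<lambda>\<omega>. (1 - ?H i \<omega>) * ?z (X (Suc i) \<omega>))"
      by (rule submartingale_step[OF _ _ sub_z]) auto
    then show "expectation (\<lambda>\<omega>. ?H i \<omega> * ?z (X (Suc i) \<omega>)) - expectation (\<lambda>\<omega>. ?H i \<omega> * ?z (X i \<omega>))
      \<le> expectation (\<lambda>\<omega>. ?z (X (Suc i) \<omega>)) - expectation (\<lambda>\<omega>. ?z (X i \<omega>))"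
      unfolding left_diff_distrib mult_1
      using intH[of i i] intH[of i "Suc i"] integrable_state[of ?z i] integrable_state[of ?z "Suc i"]
      by (simp add: Bochner_Integration.integral_diff)
  qed
  also have "\<dots> = expectation (\<lambda>\<omega>. ?z (X n \<omega>)) - expectation (\<lambda>\<omega>. ?z (X 0 \<omega>))"
    by (rule sum_lessThan_telescope)
  also have "\<dots> \<le> expectation (\<lambda>\<omega>. \<phi> (X n \<omega>) + \<bar>a\<bar>) - expectation (\<lambda>\<omega>. a)"
  proof (intro diff_mono integral_mono_AE)
    show "AE \<omega> in M. ?z (X n \<omega>) \<le> \<phi> (X n \<omega>) + \<bar>a\<bar>"
      using AE_admissible
    proof eventually_elim
      case (elim \<omega>)
      then have "0 \<le> \<phi> (X n \<omega>)" using nonneg by blast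
      then show ?case by linarith
    qed
  qed (auto intro!: integrable_state Bochner_Integration.integrable_add)
  also have "\<dots> \<le> K + 2 * \<bar>a\<bar>"
    using bound[of n] integrable_state[of \<phi> n] by (simp add: prob_space)
  finally show "expectation (\<lambda>\<omega>. real (upcrossings a b (?y \<omega>) n)) \<le> (K + 2 * \<bar>a\<bar>) / (b - a)"
    using ab by (simp add: field_simps)
qed (rule upcrossings_mono)

text \<open>Fatou makes the liminf integrable, hence finite almost surely, and any number above the
  liminf is undercut infinitely often.\<close>

lemma submartingale_frequently_bounded:
  fixes \<phi> :: "urn_state \<Rightarrow> real"
  assumes nonneg: "\<And>s. admissible s \<Longrightarrow> 0 \<le> \<phi> s"
    and bound: "\<And>n. expectation (\<lambda>\<omega>. \<phi> (X n \<omega>)) \<le> K"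
  shows "AE \<omega> in M. \<exists>B. \<exists>\<^sub>F n in sequentially. \<phi> (X n \<omega>) \<le> B"
proof -
  have "(\<integral>\<^sup>+\<omega>. liminf (\<lambda>n. ennreal (\<phi> (X n \<omega>))) \<partial>M) \<le> liminf (\<lambda>n. \<integral>\<^sup>+\<omega>. ennreal (\<phi> (X n \<omega>)) \<partial>M)"
    by (rule nn_integral_liminf) measurable
  also have "\<dots> \<le> liminf (\<lambda>n::nat. ennreal K)"
  proof (intro Liminf_mono always_eventually allI)
    fix n
    have "AE \<omega> in M. 0 \<le> \<phi> (X n \<omega>)" using AE_admissible by eventually_elim (use nonneg in auto)
    then show "(\<integral>\<^sup>+\<omega>. ennreal (\<phi> (X n \<omega>)) \<partial>M) \<le> ennreal K"
      using bound[of n] by (subst nn_integral_eq_integral[OF integrable_state]) (auto intro: ennreal_leI)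
  qed
  also have "\<dots> = ennreal K" by (simp add: Liminf_const)
  finally have "(\<integral>\<^sup>+\<omega>. liminf (\<lambda>n. ennreal (\<phi> (X n \<omega>))) \<partial>M) \<noteq> \<infinity>" by (auto simp: top_unique)
  then have "AE \<omega> in M. liminf (\<lambda>n. ennreal (\<phi> (X n \<omega>))) \<noteq> \<infinity>"
    by (intro nn_integral_PInf_AE) auto
  then show ?thesis
  proof eventually_elim
    case (elim \<omega>)
    then obtain r where r: "liminf (\<lambda>n. ennreal (\<phi> (X n \<omega>))) = ennreal r" "0 \<le> r"
      by (cases "liminf (\<lambda>n. ennreal (\<phi> (X n \<omega>)))") auto
    have "\<exists>\<^sub>F n in sequentially. \<phi> (X n \<omega>) \<le> r + 1"
    proof (rule ccontr)
      assume "\<not> (\<exists>\<^sub>F n in sequentially. \<phi> (X n \<omega>) \<le> r + 1)"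
      then have "\<forall>\<^sub>F n in sequentially. ennreal (r + 1) \<le> ennreal (\<phi> (X n \<omega>))"
        by (simp add: frequently_def not_le) (auto elim!: eventually_mono intro!: ennreal_leI)
      then have "ennreal (r + 1) \<le> ennreal r"
        unfolding r(1)[symmetric] by (rule Liminf_bounded)
      then show False using r(2) by simp
    qed
    then show ?case by blast
  qed
qed

lemma submartingale_convergent:
  assumes sub: "\<And>s. admissible s \<Longrightarrow> \<phi> s \<le> step_exp p \<phi> s"
    and nonneg: "\<And>s. admissible s \<Longrightarrow> 0 \<le> \<phi> s"
    and bound: "\<And>n. expectation (\<lambda>\<omega>. \<phi> (X n \<omega>)) \<le> K"
  shows "AE \<omega> in M. convergent (\<lambda>n. \<phi> (X n \<omega>))"
proof -
  have "AE \<omega> in M. \<forall>a\<in>\<rat>. \<forall>b\<in>\<rat>. a < b \<longrightarrow> bdd_above (range (upcrossings a b (\<lambda>n. \<phi> (X n \<omega>))))"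
    using submartingale_upcrossings[OF sub nonneg bound]
    by (simp add: AE_ball_countable countable_rat)
  moreover have "AE \<omega> in M. \<exists>B. \<exists>\<^sub>F n in sequentially. \<phi> (X n \<omega>) \<le> B"
    using nonneg bound by (rule submartingale_frequently_bounded)
  ultimately show ?thesis
    using AE_admissible
  proof eventually_elim
    case (elim \<omega>)
    then obtain B where "\<exists>\<^sub>F n in sequentially. \<phi> (X n \<omega>) \<le> B" by blast
    then show ?case
      using elim nonneg by (intro convergent_if_finitely_many_upcrossings[of _ B]) auto
  qed
qed

end

section \<open>Positivity of the limits\<close>

locale supercritical_urn = infinite_colour_urn M p X + urn_parameter p
  for M :: "'a measure" and p :: real and X
begin

text \<open>The mean of (1/2)^N shrinks by the factor p/2 + (1 - p) = 1 - p/2 per step, so the sum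
  of these variables over time has finite mean and its terms tend to 0 almost surely.\<close>

lemma AE_num_balls_at_top: "AE \<omega> in M. filterlim (\<lambda>n. num_balls (X n \<omega>)) at_top sequentially"
proof -
  let ?h = "\<lambda>s. (1 / 2 :: real) ^ num_balls s" and ?c = "1 - p / 2"
  have step: "step_exp p ?h s = ?c * ?h s" if "admissible s" for s
    using step_exp_num_balls[OF that p_bounds(1,2), of "\<lambda>n. (1 / 2) ^ n"] by (simp add: algebra_simps)
  have E_Suc: "expectation (\<lambda>\<omega>. ?h (X (Suc n) \<omega>)) = ?c * expectation (\<lambda>\<omega>. ?h (X n \<omega>))" for n
  proof -
    have "expectation (\<lambda>\<omega>. ?h (X (Suc n) \<omega>)) = expectation (\<lambda>\<omega>. step_exp p ?h (X n \<omega>))"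
      using expectation_step[OF adapted_const[of n 1], of ?h] by simp
    also have "\<dots> = expectation (\<lambda>\<omega>. ?c * ?h (X n \<omega>))"
      by (intro integral_cong_AE) (use AE_admissible in \<open>auto elim!: eventually_mono intro: step\<close>)
    finally show ?thesis by simp
  qed
  define e where "e = expectation (\<lambda>\<omega>. ?h (X 0 \<omega>))"
  have E: "expectation (\<lambda>\<omega>. ?h (X n \<omega>)) = ?c ^ n * e" for n
  proof (induction n)
    case (Suc n)
    then show ?case unfolding E_Suc by simp
  qed (simp add: e_def)
  have "0 \<le> e" unfolding e_def by (intro integral_nonneg_AE) auto
  have "(\<integral>\<^sup>+\<omega>. (\<Sum>n. ennreal (?h (X n \<omega>))) \<partial>M) = (\<Sum>n. \<integral>\<^sup>+\<omega>. ennreal (?h (X n \<omega>)) \<partial>M)"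
    by (rule nn_integral_suminf) measurable
  also have "\<dots> = (\<Sum>n. ennreal (?c ^ n * e))"
    by (subst nn_integral_eq_integral[OF integrable_state]) (simp_all add: E)
  also have "\<dots> \<noteq> \<infinity>"
  proof -
    have "summable (\<lambda>n. ?c ^ n * e)"
      using p_bounds by (intro summable_mult2 summable_geometric) auto
    moreover have "0 \<le> ?c ^ n * e" for n
      using p_bounds by (intro mult_nonneg_nonneg zero_le_power \<open>0 \<le> e\<close>) auto
    ultimately show ?thesis by (subst suminf_ennreal2) auto
  qed
  finally have "AE \<omega> in M. (\<Sum>n. ennreal (?h (X n \<omega>))) \<noteq> \<infinity>"
    by (intro nn_integral_PInf_AE) auto
  then show ?thesis
  proof eventually_elim
    case (elim \<omega>)
    then have "summable (\<lambda>n. ?h (X n \<omega>))" by (intro summable_suminf_not_top) auto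
    then have lim: "(\<lambda>n. ?h (X n \<omega>)) \<longlonglongrightarrow> 0" by (rule summable_LIMSEQ_zero)
    show ?case unfolding filterlim_at_top
    proof
      fix m
      have "\<forall>\<^sub>F n in sequentially. ?h (X n \<omega>) < (1 / 2) ^ m"
        by (rule order_tendstoD[OF lim]) simp
      then show "\<forall>\<^sub>F n in sequentially. m \<le> num_balls (X n \<omega>)"
        by eventually_elim (simp add: power_strict_decreasing_iff)
    qed
  qed
qed

end

section \<open>From moments to the maximum\<close>

text \<open>Here \<open>m\<close> plays the normalised maximum, \<open>v k\<close> the normalised
  moments and \<open>e\<close> the error of replacing rising factorials by powers. Let A be the
  limsup of \<open>m\<close>. A subsequence realising it and \<open>upper\<close> give A^k <=
  \<sigma> k. Since \<open>v k\<close> converges along the whole sequence, \<open>lower\<close> then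
  pushes \<open>m\<close> eventually above every z < A.\<close>

lemma tendsto_of_power_sums:
  fixes m e \<sigma> :: "nat \<Rightarrow> real" and v :: "nat \<Rightarrow> nat \<Rightarrow> real"
  assumes k0: "1 \<le> k0"
    and v: "\<And>k. k0 \<le> k \<Longrightarrow> v k \<longlonglongrightarrow> \<sigma> k" "\<And>k. k0 \<le> k \<Longrightarrow> 0 < \<sigma> k"
    and m: "\<And>n. 0 \<le> m n"
    and e: "\<And>n. 0 \<le> e n" "e \<longlonglongrightarrow> 0"
    and upper: "\<And>k n. k0 \<le> k \<Longrightarrow> m n ^ k \<le> v k n"
    and lower: "\<And>k n. k0 \<le> k \<Longrightarrow> v k n \<le> (m n + real k * e n) ^ (k - k0) * v k0 n"
  shows "\<exists>L>0. m \<longlonglongrightarrow> L"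
proof -
  let ?x = "\<lambda>n. ereal (m n)"
  have "Bseq (v k0)" using v(1)[of k0] by (intro convergent_imp_Bseq convergentI) auto
  then obtain B where B: "\<And>n. \<bar>v k0 n\<bar> \<le> B" unfolding Bseq_def by auto
  have mB: "m n \<le> 1 + B" for n
  proof (cases "m n \<le> 1")
    case True
    then show ?thesis using B[of n] by linarith
  next
    case False
    then have "m n ^ 1 \<le> m n ^ k0" using k0 by (intro power_increasing) auto
    then show ?thesis using upper[of k0 n] B[of n] by simp
  qed
  have "0 \<le> limsup ?x" using le_Limsup[of sequentially 0 ?x] m by (simp add: zero_ereal_def)
  moreover have "limsup ?x \<le> ereal (1 + B)" using mB by (intro Limsup_bounded) auto
  ultimately obtain A where A: "limsup ?x = ereal A" "0 \<le> A" by (cases "limsup ?x") auto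
  obtain r where r: "strict_mono r" "(?x \<circ> r) \<longlonglongrightarrow> limsup ?x" using limsup_subseq_lim by blast
  then have mr: "(\<lambda>n. m (r n)) \<longlonglongrightarrow> A" by (simp add: A o_def)
  have vr: "(\<lambda>n. v k (r n)) \<longlonglongrightarrow> \<sigma> k" if "k0 \<le> k" for k
    using LIMSEQ_subseq_LIMSEQ[OF v(1)[OF that] r(1)] by (simp add: o_def)
  have er: "(\<lambda>n. e (r n)) \<longlonglongrightarrow> 0"
    using LIMSEQ_subseq_LIMSEQ[OF e(2) r(1)] by (simp add: o_def)
  have pow: "A ^ k \<le> \<sigma> k" if "k0 \<le> k" for k
    using tendsto_power[OF mr, of k] vr[OF that] upper[OF that] by (intro LIMSEQ_le[of _ _ _ "\<sigma> k"]) auto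
  have A0: "0 < A"
  proof (rule ccontr)
    assume "\<not> 0 < A"
    then have "A = 0" using A by simp
    \<comment> \<open>One order above \<open>k0\<close> suffices: if A = 0, the single extra factor
      in \<open>lower\<close> forces \<sigma> (k0 + 1) <= 0.\<close>
    have "(\<lambda>n. (m (r n) + real (Suc k0) * e (r n)) ^ (Suc k0 - k0) * v k0 (r n)) \<longlonglongrightarrow>
        (A + real (Suc k0) * 0) ^ (Suc k0 - k0) * \<sigma> k0"
      by (intro tendsto_intros mr er vr) simp
    then have "\<sigma> (Suc k0) \<le> (A + real (Suc k0) * 0) ^ (Suc k0 - k0) * \<sigma> k0"
      using vr[of "Suc k0"] lower[of "Suc k0"] by (intro LIMSEQ_le[of _ "\<sigma> (Suc k0)"]) auto
    then show False using v(2)[of "Suc k0"] \<open>A = 0\<close> by simp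
  qed
  have "m \<longlonglongrightarrow> A"
  proof (rule order_tendstoI)
    fix y assume "A < y"
    then have "limsup ?x < ereal y" by (simp add: A)
    then have "\<forall>\<^sub>F n in sequentially. ?x n < ereal y" by (rule Limsup_lessD)
    then show "\<forall>\<^sub>F n in sequentially. m n < y" by simp
  next
    fix y assume "y < A"
    define z where "z = (max y 0 + A) / 2"
    have z: "y < z" "0 < z" "z < A" using \<open>y < A\<close> A0 by (auto simp: z_def max_def)
    \<comment> \<open>The ratio of \<sigma> at k0 + j and at k0 is at least c * A^j. However small c
      is, (z / A)^j falls below it for large j; this is where arbitrarily high moments
      enter.\<close>
    define c where "c = A ^ k0 / \<sigma> k0"
    have c: "0 < c" unfolding c_def using A0 v(2)[of k0] by simp
    have "z / A < 1" using z A0 by simp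
    then obtain j where j: "(z / A) ^ j < c" using real_arch_pow_inv[OF c] by blast
    let ?k = "k0 + j"
    have "z ^ j < c * A ^ j" using j A0 by (simp add: power_divide divide_simps)
    also have "\<dots> = A ^ ?k / \<sigma> k0" by (simp add: c_def power_add)
    also have "\<dots> \<le> \<sigma> ?k / \<sigma> k0" using pow[of ?k] v(2)[of k0] by (intro divide_right_mono) auto
    finally have zj: "z ^ j < \<sigma> ?k / \<sigma> k0" .
    have "(\<lambda>n. v ?k n / v k0 n) \<longlonglongrightarrow> \<sigma> ?k / \<sigma> k0"
      using v(2)[of k0] by (intro tendsto_divide v) auto
    then have 1: "\<forall>\<^sub>F n in sequentially. z ^ j < v ?k n / v k0 n"
      using zj by (rule order_tendstoD)
    have 2: "\<forall>\<^sub>F n in sequentially. 0 < v k0 n"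
      using v(1)[of k0] v(2)[of k0] by (intro order_tendstoD) auto
    have "(\<lambda>n. real ?k * e n) \<longlonglongrightarrow> real ?k * 0" by (intro tendsto_intros e)
    then have 3: "\<forall>\<^sub>F n in sequentially. real ?k * e n < z - y"
      using z by (intro order_tendstoD) auto
    show "\<forall>\<^sub>F n in sequentially. y < m n"
      using 1 2 3
    proof eventually_elim
      case (elim n)
      have "v ?k n / v k0 n \<le> (m n + real ?k * e n) ^ j"
        using lower[of ?k n] elim by (simp add: divide_simps)
      with elim have "z ^ j < (m n + real ?k * e n) ^ j" by linarith
      then have "z < m n + real ?k * e n"
        by (rule power_less_imp_less_base) (intro add_nonneg_nonneg mult_nonneg_nonneg m e, simp)
      with elim show ?case by linarith
    qed
  qed
  with A0 show ?thesis by blast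
qed

lemma power_le_pochhammer: "real x ^ k \<le> pochhammer (real x) k"
proof -
  have "(\<Prod>i = 0..<k. real x) \<le> pochhammer (real x) k"
    unfolding pochhammer_prod by (intro prod_mono) auto
  then show ?thesis by simp
qed

lemma count_le_leading_count: "count (snd s) c \<le> leading_count s"
  unfolding leading_count_def by (rule Max_ge[OF finite_range_count]) simp

lemma leading_count_power_le:
  assumes "admissible s" "1 \<le> k"
  shows "real (leading_count s) ^ k \<le> rising_moment k s"
proof -
  have "leading_count s \<in> range (count (snd s))"
    unfolding leading_count_def by (rule Max_in[OF finite_range_count]) simp
  then obtain c where c: "leading_count s = count (snd s) c" by blast
  show ?thesis
  proof (cases "c \<in># snd s")
    case True
    then have "c \<in> {..<fst s}" using assms by (auto simp: admissible_def)
    then have "pochhammer (real (count (snd s) c)) k \<le> rising_moment k s"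
      unfolding rising_moment_def colour_sum_def
      by (intro member_le_sum[where f = "\<lambda>c. pochhammer (real (count (snd s) c)) k"] pochhammer_real_nonneg) auto
    then show ?thesis unfolding c using power_le_pochhammer by (rule order_trans[rotated])
  next
    case False
    then show ?thesis using assms(2) rising_moment_nonneg by (simp add: c not_in_iff power_0_left)
  qed
qed

lemma rising_moment_le_leading_count:
  assumes "k \<le> k'"
  shows "rising_moment k' s \<le> (real (leading_count s) + real k') ^ (k' - k) * rising_moment k s"
  unfolding rising_moment_def colour_sum_def sum_distrib_left
proof (rule sum_mono)
  fix c
  let ?x = "real (count (snd s) c)"
  have "pochhammer (?x + real k) (k' - k) \<le> (\<Prod>i = 0..<k' - k. real (leading_count s) + real k')"
    unfolding pochhammer_prod
    using count_le_leading_count[of s c] assms by (intro prod_mono) auto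
  then have "pochhammer ?x k * pochhammer (?x + real k) (k' - k) \<le>
      pochhammer ?x k * (real (leading_count s) + real k') ^ (k' - k)"
    by (intro mult_left_mono pochhammer_real_nonneg) simp
  then show "pochhammer ?x k' \<le> (real (leading_count s) + real k') ^ (k' - k) * pochhammer ?x k"
    unfolding pochhammer_product[OF assms] by (simp add: mult.commute)
qed

context urn_parameter
begin

text \<open>The quotient of two \<open>Gamma_series\<close> is this weight times a power of n, so L
  is a quotient of Gamma values. The exponent k - k q / p equals k * drift / p.\<close>

lemma weight_asymptotics:
  assumes k: "1 \<le> k"
  shows "\<exists>L>0. (\<lambda>n. weight k n * real n powr (real k * (drift / p))) \<longlonglongrightarrow> L"
proof -
  let ?a = "real k * q / p" and ?b = "real k" and ?c = "real k * (drift / p)"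
  have ab: "0 < ?a" "0 < ?b" using k p_bounds q_bounds by auto
  have abc: "?b - ?a = ?c" using p_bounds by (simp add: drift_bounds(3) field_simps)
  let ?L = "Gamma ?b / Gamma ?a"
  have "(\<lambda>n. Gamma_series ?b n / Gamma_series ?a n) \<longlonglongrightarrow> ?L"
    using Gamma_real_pos[OF ab(1)] by (intro tendsto_divide Gamma_series_LIMSEQ) auto
  moreover have "\<forall>\<^sub>F n in sequentially. Gamma_series ?b n / Gamma_series ?a n = weight k (Suc n) * real n powr ?c"
    using eventually_gt_at_top[of 0]
  proof eventually_elim
    case (elim n)
    have "?b = ?a + ?c" using abc by simp
    then have "?b * ln (real n) = (?a + ?c) * ln (real n)" by (rule arg_cong)
    then have "exp (?b * ln (real n)) = exp (?a * ln (real n)) * real n powr ?c"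
      using elim by (simp only: distrib_right exp_add powr_def) simp
    then show ?case by (simp add: Gamma_series_def weight_def)
  qed
  ultimately have 1: "(\<lambda>n. weight k (Suc n) * real n powr ?c) \<longlonglongrightarrow> ?L"
    by (rule Lim_transform_eventually)
  \<comment> \<open>\<open>Gamma_series\<close> at n has n + 1 factors and so yields the weight at n
    + 1; dividing by the one-step ratio, which tends to 1, returns to n.\<close>
  have 2: "(\<lambda>n. (p * real n + q * real k) / (p * (real n + real k))) \<longlonglongrightarrow> 1"
    using p_bounds by real_asymp
  have "(\<lambda>n. weight k (Suc n) * real n powr ?c / ((p * real n + q * real k) / (p * (real n + real k)))) \<longlonglongrightarrow> ?L / 1"
    by (intro tendsto_divide 1 2) simp
  moreover have "weight k (Suc n) * real n powr ?c / ((p * real n + q * real k) / (p * (real n + real k))) =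
      weight k n * real n powr ?c" for n
  proof -
    define R where "R = (p * real n + q * real k) / (p * (real n + real k))"
    have "0 < R"
      unfolding R_def using p_bounds q_bounds k by (intro divide_pos_pos add_nonneg_pos mult_pos_pos) auto
    then show ?thesis by (simp add: weight_Suc[OF k] R_def[symmetric])
  qed
  ultimately show ?thesis
    using Gamma_real_pos ab by (intro exI[of _ ?L]) simp
qed

lemma scaled_moment_nonneg: "1 \<le> k \<Longrightarrow> 0 \<le> scaled_moment k s"
  unfolding scaled_moment_def using weight_pos[of k] rising_moment_nonneg by (simp add: less_imp_le)

end

section \<open>Convergence and positivity of the scaled moments\<close>

context supercritical_urn
begin

context
  fixes k :: nat
  assumes k: "2 \<le> k" "p < real k * drift"
begin

abbreviation V :: "nat \<Rightarrow> 'a \<Rightarrow> real" where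
  "V n \<omega> \<equiv> scaled_moment k (X n \<omega>)"

lemma k_ge_1: "1 \<le> k" using k by simp

lemma V_nonneg: "0 \<le> V n \<omega>" by (rule scaled_moment_nonneg[OF k_ge_1])

text \<open>The mean of \<open>V\<close> is bounded through its second moment: V <= 1 + V^2, and the
  square lies below a supermartingale.\<close>

lemma AE_V_convergent: "AE \<omega> in M. convergent (\<lambda>n. V n \<omega>)"
proof (rule submartingale_convergent)
  obtain C where C: "\<And>s. admissible s \<Longrightarrow> scaled_moment k s ^ 2 \<le> square_majorant k s"
    using square_majorant_bounds[OF k] by blast
  fix n
  have "expectation (V n) \<le> expectation (\<lambda>\<omega>. 1 + square_majorant k (X n \<omega>))"
  proof (rule integral_mono_AE)
    show "AE \<omega> in M. V n \<omega> \<le> 1 + square_majorant k (X n \<omega>)"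
      using AE_admissible
    proof eventually_elim
      case (elim \<omega>)
      have "2 * V n \<omega> \<le> 1 + V n \<omega> ^ 2" using sum_squares_bound[of 1 "V n \<omega>"] by simp
      then show ?case using C[of "X n \<omega>"] elim V_nonneg[of n \<omega>] by fastforce
    qed
  qed (auto intro!: integrable_state Bochner_Integration.integrable_add)
  also have "\<dots> = 1 + expectation (\<lambda>\<omega>. square_majorant k (X n \<omega>))"
    using integrable_state[of "square_majorant k" n] by (simp add: prob_space)
  also have "\<dots> \<le> 1 + expectation (\<lambda>\<omega>. square_majorant k (X 0 \<omega>))"
    using supermartingale_mono[OF adapted_const[of 0 1], of "square_majorant k" n] square_majorant_supermartingale[OF k] by simp
  finally show "expectation (V n) \<le> 1 + expectation (\<lambda>\<omega>. square_majorant k (X 0 \<omega>))" .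
qed (use scaled_moment_submartingale[OF _ k_ge_1] V_nonneg scaled_moment_nonneg[OF k_ge_1] in auto)

abbreviation V_limit :: "'a \<Rightarrow> real" where
  "V_limit \<omega> \<equiv> lim (\<lambda>n. V n \<omega>)"

lemma V_limit_measurable [measurable]: "V_limit \<in> borel_measurable M"
  by (intro borel_measurable_lim_metric measurable_state)

lemma AE_V_tendsto: "AE \<omega> in M. (\<lambda>n. V n \<omega>) \<longlonglongrightarrow> V_limit \<omega> \<and> 0 \<le> V_limit \<omega>"
  using AE_V_convergent
proof eventually_elim
  case (elim \<omega>)
  then have "(\<lambda>n. V n \<omega>) \<longlonglongrightarrow> V_limit \<omega>" by (simp add: convergent_LIMSEQ_iff)
  then show ?case using V_nonneg by (auto intro: LIMSEQ_le_const)
qed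

text \<open>Given the past, \<open>V m\<close> has mean at least \<open>V n\<close> and second
  moment at most C times the square of \<open>V n\<close>. Expanding the square therefore gives 1 -
  2/C + 1/C; the scaling 1/C is the minimiser of 1 - 2 t + C t^2. The factor \<psi> is the test
  function for the past.\<close>

lemma weighted_second_moment:
  assumes C: "1 \<le> C" "\<And>s. admissible s \<Longrightarrow> scaled_moment k s ^ 2 \<le> square_majorant k s"
      "\<And>s. admissible s \<Longrightarrow> square_majorant k s \<le> C * scaled_moment k s ^ 2"
    and nm: "n \<le> m"
    and \<psi>: "\<And>x. 0 \<le> \<psi> x"
  shows "expectation (\<lambda>\<omega>. \<psi> (V n \<omega>) * (1 - V m \<omega> / (C * V n \<omega>)) ^ 2) \<le>
    (1 - 1 / C) * expectation (\<lambda>\<omega>. \<psi> (V n \<omega>))"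
proof -
  let ?h = "\<lambda>\<omega>. \<psi> (V n \<omega>)"
  let ?h1 = "\<lambda>\<omega>. \<psi> (V n \<omega>) / (C * V n \<omega>)" and ?h2 = "\<lambda>\<omega>. \<psi> (V n \<omega>) / (C * V n \<omega>) ^ 2"
  have ad: "adapted n ?h" "adapted n ?h1" "adapted n ?h2" by (rule adapted_state[OF order_refl])+
  have h1: "0 \<le> ?h1 \<omega>" and h2: "0 \<le> ?h2 \<omega>" for \<omega>
    using \<psi> V_nonneg[of n \<omega>] C(1) by (auto intro!: divide_nonneg_nonneg mult_nonneg_nonneg)
  have int: "integrable M (\<lambda>\<omega>. H \<omega> * \<phi> (X m \<omega>))" if "adapted n H" for H \<phi>
    by (rule adapted_integrable[of m]) (intro adapted_mult adapted_mono[OF that nm] adapted_state order_refl)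
  have AE_pos: "AE \<omega> in M. admissible (X n \<omega>) \<and> 0 < V n \<omega>"
    using AE_admissible by eventually_elim (auto intro: scaled_moment_pos k_ge_1)
  have 1: "expectation ?h / C \<le> expectation (\<lambda>\<omega>. ?h1 \<omega> * V m \<omega>)"
  proof -
    have "expectation ?h / C = expectation (\<lambda>\<omega>. ?h \<omega> / C)" by simp
    also have "\<dots> = expectation (\<lambda>\<omega>. ?h1 \<omega> * V n \<omega>)"
    proof (rule integral_cong_AE)
      show "AE \<omega> in M. ?h \<omega> / C = ?h1 \<omega> * V n \<omega>"
        using AE_pos by eventually_elim simp
    qed (rule measurable_state)+
    also have "\<dots> \<le> expectation (\<lambda>\<omega>. ?h1 \<omega> * V m \<omega>)"
      using scaled_moment_submartingale[OF _ k_ge_1] by (intro submartingale_mono ad h1 nm) auto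
    finally show ?thesis .
  qed
  have "expectation (\<lambda>\<omega>. ?h2 \<omega> * V m \<omega> ^ 2) \<le> expectation (\<lambda>\<omega>. ?h2 \<omega> * square_majorant k (X m \<omega>))"
  proof (rule integral_mono_AE)
    show "AE \<omega> in M. ?h2 \<omega> * V m \<omega> ^ 2 \<le> ?h2 \<omega> * square_majorant k (X m \<omega>)"
      using AE_admissible
    proof eventually_elim
      case (elim \<omega>)
      then show ?case by (intro mult_left_mono[OF C(2) h2]) blast
    qed
  qed (rule int[OF ad(3), of "\<lambda>s. scaled_moment k s ^ 2"] int[OF ad(3)])+
  also have "\<dots> \<le> expectation (\<lambda>\<omega>. ?h2 \<omega> * square_majorant k (X n \<omega>))"
    using square_majorant_supermartingale[OF k] by (intro supermartingale_mono ad h2 nm) auto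
  also have "\<dots> \<le> expectation (\<lambda>\<omega>. ?h \<omega> / C)"
  proof (rule integral_mono_AE)
    show "AE \<omega> in M. ?h2 \<omega> * square_majorant k (X n \<omega>) \<le> ?h \<omega> / C"
      using AE_pos
    proof eventually_elim
      case (elim \<omega>)
      then have "?h2 \<omega> * square_majorant k (X n \<omega>) \<le> ?h2 \<omega> * (C * V n \<omega> ^ 2)"
        using C(3) h2 by (intro mult_left_mono) auto
      also have "\<dots> = ?h \<omega> / C" using elim C(1) by (simp add: power2_eq_square)
      finally show ?case .
    qed
    show "integrable M (\<lambda>\<omega>. ?h2 \<omega> * square_majorant k (X n \<omega>))" "integrable M (\<lambda>\<omega>. ?h \<omega> / C)"
      by (rule integrable_state)+
  qed
  finally have 2: "expectation (\<lambda>\<omega>. ?h2 \<omega> * V m \<omega> ^ 2) \<le> expectation ?h / C" by simp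
  have i0: "integrable M ?h" and i1: "integrable M (\<lambda>\<omega>. ?h1 \<omega> * V m \<omega>)"
    and i2: "integrable M (\<lambda>\<omega>. ?h2 \<omega> * V m \<omega> ^ 2)"
    using integrable_state int[OF ad(2)] int[OF ad(3), of "\<lambda>s. scaled_moment k s ^ 2"] by auto
  have "expectation (\<lambda>\<omega>. \<psi> (V n \<omega>) * (1 - V m \<omega> / (C * V n \<omega>)) ^ 2) =
      expectation (\<lambda>\<omega>. (?h \<omega> - 2 * (?h1 \<omega> * V m \<omega>)) + ?h2 \<omega> * V m \<omega> ^ 2)"
    by (intro Bochner_Integration.integral_cong) (simp_all add: power2_eq_square algebra_simps)
  also have "\<dots> = expectation ?h - 2 * expectation (\<lambda>\<omega>. ?h1 \<omega> * V m \<omega>) + expectation (\<lambda>\<omega>. ?h2 \<omega> * V m \<omega> ^ 2)"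
    using i0 i1 i2 by (simp only: Bochner_Integration.integral_add Bochner_Integration.integral_diff
      Bochner_Integration.integrable_diff integrable_mult_right integral_mult_right_zero)
  also have "\<dots> \<le> (1 - 1 / C) * expectation ?h"
    using 1 2 by (simp add: left_diff_distrib)
  finally show ?thesis .
qed

text \<open>
  Where the limit vanishes, the squared factor in \<open>weighted_second_moment\<close> tends to 1, so Fatou's lemma applies.
\<close>

lemma weighted_extinction_bound:
  assumes C: "1 \<le> C" "\<And>s. admissible s \<Longrightarrow> scaled_moment k s ^ 2 \<le> square_majorant k s"
      "\<And>s. admissible s \<Longrightarrow> square_majorant k s \<le> C * scaled_moment k s ^ 2"
    and \<psi>: "\<And>x. 0 \<le> \<psi> x" "\<And>x. \<psi> x \<le> 1 \<or> x < 0" and [measurable]: "\<psi> \<in> borel_measurable borel"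
  shows "expectation (\<lambda>\<omega>. \<psi> (V n \<omega>) * indicator {0} (V_limit \<omega>)) \<le>
    (1 - 1 / C) * expectation (\<lambda>\<omega>. \<psi> (V n \<omega>))"
proof -
  let ?f = "\<lambda>m \<omega>. \<psi> (V n \<omega>) * (1 - V (n + m) \<omega> / (C * V n \<omega>)) ^ 2"
  let ?R = "(1 - 1 / C) * expectation (\<lambda>\<omega>. \<psi> (V n \<omega>))"
  have R: "0 \<le> ?R" using C(1) \<psi>(1) by (intro mult_nonneg_nonneg integral_nonneg_AE) auto
  have f0: "0 \<le> ?f m \<omega>" for m \<omega> using \<psi>(1) by simp
  have int_f: "integrable M (?f m)" for m
    by (rule adapted_integrable[of "n + m"])
      (rule adapted_comp2[OF adapted_state adapted_state, of n "n + m" "n + m" "\<lambda>x y. \<psi> x * (1 - y / (C * x)) ^ 2"], simp_all)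
  have [measurable]: "?f m \<in> borel_measurable M" for m
    using int_f by (rule borel_measurable_integrable)
  \<comment> \<open>The bound on \<psi> concerns nonnegative arguments only, as suits x -> exp (- j
    x).\<close>
  have "\<psi> (V n \<omega>) \<le> 1" for \<omega> using \<psi>(2)[of "V n \<omega>"] V_nonneg[of n \<omega>] by linarith
  then have int_g: "integrable M (\<lambda>\<omega>. \<psi> (V n \<omega>) * indicator {0} (V_limit \<omega>))"
    using \<psi>(1) by (intro integrable_const_bound[where B = 1]) (auto simp: indicator_def)
  have "ennreal (expectation (\<lambda>\<omega>. \<psi> (V n \<omega>) * indicator {0} (V_limit \<omega>))) =
      (\<integral>\<^sup>+\<omega>. ennreal (\<psi> (V n \<omega>) * indicator {0} (V_limit \<omega>)) \<partial>M)"
    using \<psi>(1) by (intro nn_integral_eq_integral[symmetric] int_g) auto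
  also have "\<dots> \<le> (\<integral>\<^sup>+\<omega>. liminf (\<lambda>m. ennreal (?f m \<omega>)) \<partial>M)"
  proof (rule nn_integral_mono_AE)
    show "AE \<omega> in M. ennreal (\<psi> (V n \<omega>) * indicator {0} (V_limit \<omega>)) \<le> liminf (\<lambda>m. ennreal (?f m \<omega>))"
      using AE_V_tendsto
    proof eventually_elim
      case (elim \<omega>)
      show ?case
      proof (cases "V_limit \<omega> = 0")
        case True
        then have "(\<lambda>m. V (m + n) \<omega>) \<longlonglongrightarrow> 0" using elim by (intro LIMSEQ_ignore_initial_segment) simp
        \<comment> \<open>Only m varies, so the division is multiplication by a constant inverse,
          and no nonvanishing of the denominator has to be shown.\<close>
        then have "(\<lambda>m. ?f m \<omega>) \<longlonglongrightarrow> \<psi> (V n \<omega>) * (1 - 0 / (C * V n \<omega>)) ^ 2"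
          unfolding add.commute[of n] divide_inverse by (intro tendsto_intros)
        then have "(\<lambda>m. ennreal (?f m \<omega>)) \<longlonglongrightarrow> ennreal (\<psi> (V n \<omega>))" by (intro tendsto_ennrealI) simp
        then have "liminf (\<lambda>m. ennreal (?f m \<omega>)) = ennreal (\<psi> (V n \<omega>))"
          by (intro lim_imp_Liminf) simp_all
        then show ?thesis using True by simp
      qed simp
    qed
  qed
  also have "\<dots> \<le> liminf (\<lambda>m. \<integral>\<^sup>+\<omega>. ennreal (?f m \<omega>) \<partial>M)"
    by (rule nn_integral_liminf) measurable
  also have "\<dots> \<le> liminf (\<lambda>m::nat. ennreal ?R)"
  proof (intro Liminf_mono always_eventually allI)
    fix m
    have "(\<integral>\<^sup>+\<omega>. ennreal (?f m \<omega>) \<partial>M) = ennreal (expectation (?f m))"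
      using f0 by (intro nn_integral_eq_integral int_f) auto
    also have "\<dots> \<le> ennreal ?R"
      using C \<psi>(1) by (intro ennreal_leI weighted_second_moment) auto
    finally show "(\<integral>\<^sup>+\<omega>. ennreal (?f m \<omega>) \<partial>M) \<le> ennreal ?R" .
  qed
  also have "\<dots> = ennreal ?R" by (simp add: Liminf_const)
  finally show ?thesis using R by simp
qed

text \<open>Testing with exp (- j V_n) and letting n grow bounds P(V_limit = 0) by 1 - 1/C times the
  Laplace transform of the limit at j. As j grows, the transform decreases to P(V_limit = 0) itself,
  so this probability is at most 1 - 1/C times itself and must be 0. The argument takes the place of
  a zero-one law for conditional probabilities.\<close>

lemma AE_V_limit_pos: "AE \<omega> in M. 0 < V_limit \<omega>"
proof -
  obtain C where C: "1 \<le> C" "\<And>s. admissible s \<Longrightarrow> scaled_moment k s ^ 2 \<le> square_majorant k s"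
      "\<And>s. admissible s \<Longrightarrow> square_majorant k s \<le> C * scaled_moment k s ^ 2"
    using square_majorant_bounds[OF k] by blast
  let ?I = "\<lambda>\<omega>. indicator {0} (V_limit \<omega>) :: real"
  let ?P = "expectation ?I"
  have V_le: "exp (- (real j * V n \<omega>)) \<le> 1" for j n \<omega> using V_nonneg by simp
  have 1: "?P \<le> (1 - 1 / C) * expectation (\<lambda>\<omega>. exp (- (real j * V_limit \<omega>)))" for j
  proof (rule LIMSEQ_le)
    show "(\<lambda>n. expectation (\<lambda>\<omega>. exp (- (real j * V n \<omega>)) * ?I \<omega>)) \<longlonglongrightarrow> ?P"
    proof (rule integral_dominated_convergence[where w = "\<lambda>_. 1"])
      show "AE \<omega> in M. (\<lambda>n. exp (- (real j * V n \<omega>)) * ?I \<omega>) \<longlonglongrightarrow> ?I \<omega>"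
        using AE_V_tendsto
      proof eventually_elim
        case (elim \<omega>)
        then have "(\<lambda>n. exp (- (real j * V n \<omega>)) * ?I \<omega>) \<longlonglongrightarrow> exp (- (real j * V_limit \<omega>)) * ?I \<omega>"
          by (intro tendsto_intros) auto
        then show ?case by (auto simp: indicator_def split: if_splits)
      qed
    qed (use V_le in \<open>auto simp: indicator_def\<close>)
    show "(\<lambda>n. (1 - 1 / C) * expectation (\<lambda>\<omega>. exp (- (real j * V n \<omega>)))) \<longlonglongrightarrow>
        (1 - 1 / C) * expectation (\<lambda>\<omega>. exp (- (real j * V_limit \<omega>)))"
    proof (intro tendsto_mult_left integral_dominated_convergence[where w = "\<lambda>_. 1"])
      show "AE \<omega> in M. (\<lambda>n. exp (- (real j * V n \<omega>))) \<longlonglongrightarrow> exp (- (real j * V_limit \<omega>))"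
        using AE_V_tendsto by eventually_elim (auto intro!: tendsto_intros)
    qed (use V_le in auto)
    show "\<exists>N. \<forall>n\<ge>N. expectation (\<lambda>\<omega>. exp (- (real j * V n \<omega>)) * ?I \<omega>) \<le>
        (1 - 1 / C) * expectation (\<lambda>\<omega>. exp (- (real j * V n \<omega>)))"
      using C by (intro exI[of _ 0] allI impI weighted_extinction_bound[where \<psi> = "\<lambda>x. exp (- (real j * x))"])
        (auto simp: not_less)
  qed
  \<comment> \<open>exp (- j x) tends to 1 at x = 0 and to 0 for x > 0, so the Laplace transforms
    converge to the mass at 0.\<close>
  have "(\<lambda>j. (1 - 1 / C) * expectation (\<lambda>\<omega>. exp (- (real j * V_limit \<omega>)))) \<longlonglongrightarrow> (1 - 1 / C) * ?P"
  proof (intro tendsto_mult_left integral_dominated_convergence[where w = "\<lambda>_. 1"])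
    show "AE \<omega> in M. (\<lambda>j. exp (- (real j * V_limit \<omega>))) \<longlonglongrightarrow> ?I \<omega>"
      using AE_V_tendsto
    proof eventually_elim
      case (elim \<omega>)
      show ?case
      proof (cases "V_limit \<omega> = 0")
        case False
        then have "0 < V_limit \<omega>" using elim by simp
        moreover have "(\<lambda>j. exp (- (real j * c))) \<longlonglongrightarrow> 0" if "0 < c" for c :: real
          using that by real_asymp
        ultimately have "(\<lambda>j. exp (- (real j * V_limit \<omega>))) \<longlonglongrightarrow> 0" by blast
        then show ?thesis using False by simp
      qed simp
    qed
    show "AE \<omega> in M. norm (exp (- (real j * V_limit \<omega>))) \<le> 1" for j
      using AE_V_tendsto by eventually_elim simp
  qed auto
  then have "?P \<le> (1 - 1 / C) * ?P"
    by (rule LIMSEQ_le_const) (use 1 in blast)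
  then have "?P \<le> 0" using C(1) by (simp add: algebra_simps divide_le_0_iff)
  moreover have int: "integrable M ?I"
    by (intro integrable_const_bound[where B = 1]) (auto simp: indicator_def)
  ultimately have "?P = 0" by (intro antisym integral_nonneg_AE) auto
  then have "AE \<omega> in M. ?I \<omega> = 0"
    by (subst (asm) integral_nonneg_eq_0_iff_AE[OF int]) auto
  with AE_V_tendsto show ?thesis
    by eventually_elim (auto simp: indicator_def split: if_splits)
qed

lemma AE_normalised_moment:
  "AE \<omega> in M. \<exists>\<sigma>>0. (\<lambda>n. rising_moment k (X n \<omega>) / (real (num_balls (X n \<omega>)) powr (drift / p)) ^ k) \<longlonglongrightarrow> \<sigma>"
proof -
  obtain L where L: "0 < L" "(\<lambda>n. weight k n * real n powr (real k * (drift / p))) \<longlonglongrightarrow> L"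
    using weight_asymptotics[OF k_ge_1] by blast
  show ?thesis
    using AE_V_tendsto AE_V_limit_pos AE_num_balls_at_top AE_admissible
  proof eventually_elim
    case (elim \<omega>)
    let ?N = "\<lambda>n. num_balls (X n \<omega>)"
    have "(\<lambda>n. weight k (?N n) * real (?N n) powr (real k * (drift / p))) \<longlonglongrightarrow> L"
      using filterlim_compose[OF L(2)] elim by blast
    then have "(\<lambda>n. V n \<omega> / (weight k (?N n) * real (?N n) powr (real k * (drift / p)))) \<longlonglongrightarrow> V_limit \<omega> / L"
      using elim L(1) by (intro tendsto_divide) auto
    moreover have "V n \<omega> / (weight k (?N n) * real (?N n) powr (real k * (drift / p))) =
        rising_moment k (X n \<omega>) / (real (?N n) powr (drift / p)) ^ k" for n
    proof -
      have "0 < ?N n" using elim num_balls_pos by blast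
      then have "real (?N n) powr (real k * (drift / p)) = (real (?N n) powr (drift / p)) ^ k"
        by (simp add: powr_power mult.commute)
      then show ?thesis using weight_pos[OF k_ge_1, of "?N n"] by (simp add: scaled_moment_def)
    qed
    ultimately show ?case using elim L(1) by (intro exI[of _ "V_limit \<omega> / L"]) simp
  qed
qed

end

text \<open>Countably many orders share one null set, so on a single path all moments of order at
  least \<open>k0\<close> converge and \<open>tendsto_of_power_sums\<close> applies pathwise. The
  shift in \<open>rising_moment_le_leading_count\<close> becomes k / T after normalisation by T = N
  powr (drift / p), a vanishing error.\<close>

lemma AE_leading_count_tendsto:
  "AE \<omega> in M. \<exists>L>0. (\<lambda>n. real (leading_count (X n \<omega>)) / real (num_balls (X n \<omega>)) powr (drift / p)) \<longlonglongrightarrow> L"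
proof -
  obtain k1 :: nat where "p / drift < real k1" using reals_Archimedean2 by blast
  then have k1: "p < real k1 * drift" using drift_bounds by (simp add: divide_simps)
  define k0 where "k0 = max 2 k1"
  have k0: "2 \<le> k" "p < real k * drift" if "k0 \<le> k" for k
  proof -
    show "2 \<le> k" using that by (simp add: k0_def)
    have "real k1 * drift \<le> real k * drift" using that drift_bounds by (intro mult_right_mono) (auto simp: k0_def)
    with k1 show "p < real k * drift" by linarith
  qed
  let ?T = "\<lambda>n \<omega>. real (num_balls (X n \<omega>)) powr (drift / p)"
  have "AE \<omega> in M. \<forall>k\<in>{k0..}. \<exists>\<sigma>>0. (\<lambda>n. rising_moment k (X n \<omega>) / ?T n \<omega> ^ k) \<longlonglongrightarrow> \<sigma>"
    unfolding AE_ball_countable[OF countableI_type]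
    by (intro ballI AE_normalised_moment k0) simp_all
  then show ?thesis
    using AE_num_balls_at_top AE_admissible
  proof eventually_elim
    case (elim \<omega>)
    let ?m = "\<lambda>n. real (leading_count (X n \<omega>)) / ?T n \<omega>"
    let ?v = "\<lambda>k n. rising_moment k (X n \<omega>) / ?T n \<omega> ^ k"
    from bchoice[OF elim(1)] obtain \<sigma> where \<sigma>: "\<And>k. k0 \<le> k \<Longrightarrow> 0 < \<sigma> k \<and> ?v k \<longlonglongrightarrow> \<sigma> k"
      by auto
    have T: "0 < ?T n \<omega>" for n using elim num_balls_pos[of "X n \<omega>"] by auto
    show ?case
    proof (rule tendsto_of_power_sums[where v = ?v and \<sigma> = \<sigma> and e = "\<lambda>n. 1 / ?T n \<omega>"])
      show "1 \<le> k0" by (simp add: k0_def)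
      show "?v k \<longlonglongrightarrow> \<sigma> k" "0 < \<sigma> k" if "k0 \<le> k" for k using \<sigma>[OF that] by auto
      show "0 \<le> ?m n" "0 \<le> 1 / ?T n \<omega>" for n by auto
      have "filterlim (\<lambda>n. real (num_balls (X n \<omega>))) at_top sequentially"
        using elim(2) by (rule filterlim_compose[OF filterlim_real_sequentially])
      moreover have "((\<lambda>x. 1 / x powr (drift / p)) \<longlongrightarrow> 0) (at_top :: real filter)"
        using drift_bounds(1) p_bounds by real_asymp
      ultimately show "(\<lambda>n. 1 / ?T n \<omega>) \<longlonglongrightarrow> 0"
        by (rule filterlim_compose[rotated])
      fix k n assume k: "k0 \<le> k"
      have adm: "admissible (X n \<omega>)" using elim by blast
      show "?m n ^ k \<le> ?v k n"
        unfolding power_divide using T[of n] leading_count_power_le[OF adm, of k] k0(1)[OF k]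
        by (intro divide_right_mono) auto
      have "?m n + real k * (1 / ?T n \<omega>) = (real (leading_count (X n \<omega>)) + real k) / ?T n \<omega>"
        by (simp add: add_divide_distrib)
      moreover have "?T n \<omega> ^ k = ?T n \<omega> ^ (k - k0) * ?T n \<omega> ^ k0"
        using k by (simp add: power_add[symmetric])
      ultimately show "?v k n \<le> (?m n + real k * (1 / ?T n \<omega>)) ^ (k - k0) * ?v k0 n"
        using divide_right_mono[OF rising_moment_le_leading_count[OF k, of "X n \<omega>"], of "?T n \<omega> ^ k"]
        by (simp add: power_divide)
    qed
  qed
qed

end

theorem theorem2p11:
  fixes M :: "'a measure" and p \<beta> :: real and X :: "nat \<Rightarrow> 'a \<Rightarrow> urn_state"
  assumes "1 / 2 < p" and "p < 1"
    and "\<beta> = p / (2 * p - 1)"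
    and "infinite_colour_urn M p X"
  shows "\<exists>\<mu> :: 'a \<Rightarrow> real. \<mu> \<in> borel_measurable M \<and> (\<forall>\<omega>\<in>space M. 0 < \<mu> \<omega>) \<and>
    (AE \<omega> in M. (\<lambda>n. real (leading_count (X n \<omega>)) /
        (\<mu> \<omega> * real (num_balls (X n \<omega>)) powr (1 / \<beta>))) \<longlonglongrightarrow> 1)"
proof -
  interpret infinite_colour_urn M p X by fact
  interpret supercritical_urn M p X by unfold_locales (fact assms)+
  have beta: "1 / \<beta> = drift / p" by (simp add: assms(3) drift_def)
  let ?m = "\<lambda>n \<omega>. real (leading_count (X n \<omega>)) / real (num_balls (X n \<omega>)) powr (1 / \<beta>)"
  \<comment> \<open>The value 1 occurs on a null set only; it makes \<mu> positive everywhere, and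
    \<open>lim\<close> keeps it measurable.\<close>
  define \<mu> where "\<mu> \<omega> = (if 0 < lim (\<lambda>n. ?m n \<omega>) then lim (\<lambda>n. ?m n \<omega>) else 1)" for \<omega>
  have [measurable]: "(\<lambda>\<omega>. lim (\<lambda>n. ?m n \<omega>)) \<in> borel_measurable M"
    by (intro borel_measurable_lim_metric measurable_state[where \<phi> = "\<lambda>s. real (leading_count s) / real (num_balls s) powr (1 / \<beta>)"])
  have "\<mu> \<in> borel_measurable M" unfolding \<mu>_def by measurable
  moreover have "\<forall>\<omega>\<in>space M. 0 < \<mu> \<omega>" by (simp add: \<mu>_def)
  moreover have "AE \<omega> in M. (\<lambda>n. real (leading_count (X n \<omega>)) /
        (\<mu> \<omega> * real (num_balls (X n \<omega>)) powr (1 / \<beta>))) \<longlonglongrightarrow> 1"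
    using AE_leading_count_tendsto
  proof eventually_elim
    case (elim \<omega>)
    then obtain L where L: "0 < L" "(\<lambda>n. ?m n \<omega>) \<longlonglongrightarrow> L" unfolding beta by blast
    then have "\<mu> \<omega> = L" by (simp add: \<mu>_def limI)
    moreover have "(\<lambda>n. ?m n \<omega> / L) \<longlonglongrightarrow> L / L" using L by (intro tendsto_intros) auto
    ultimately show ?case using L(1) by (simp add: mult.commute)
  qed
  ultimately show ?thesis by blast
qed

end
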